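(* Let $(\Omega,\Sigma,\mu)$ be a probability space, let $\theta>0$, and let $p(\cdot):\Omega\to[1,\infty)$ be a measurable function with $1\le p^-\le p^+<\infty$. Let $T:\Omega\to\Omega$ be a measure-preserving transformation, and suppose that $p(\cdot)$ is $T$-invariant, i.e. $p(T(\cdot))=p(\cdot)$. Then: (i) The limit $$f_{av}(x)=\lim_{n\to\infty}\frac1n\sum_{j=0}^{n-1}f(T^j(x))$$ exists for all $f\in L^{p(\cdot),\theta}(\Omega)$ and almost each point $x\in\Omega$, and $f_{av}\in L^{p(\cdot),\theta}(\Omega)$. (ii) For every $f\in L^{p(\cdot),\theta}(\Omega)$ we have $$f_{av}(x)=f_{av}(T(x)),\qquad \int_\Omega f_{av}\,d\mu=\int_\Omega f\,d\mu .$$ (iii) For all $f\in[L^{p(\cdot)}(\Omega)]_{p(\cdot),\theta}$ we have $$\lim_{n\to\infty}\left\Vert f_{av}-\frac1n\sum_{j=0}^{n-1}f\circ T^j\right\Vert_{p(\cdot),\theta}=0 .$$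
   Context: Let $(\Omega,\Sigma,\mu)$ be a probability space. For a measurable $p(\cdot):\Omega\to[1,\infty)$ put $p^-=\operatorname{ess\,inf}_{x\in\Omega}p(x)$ and $p^+=\operatorname{ess\,sup}_{x\in\Omega}p(x)$. Variable exponent Lebesgue space: for a measurable exponent $q(\cdot):\Omega\to[1,\infty)$ with $q^+<\infty$ and a measurable function $f$ on $\Omega$, let $\varrho_{q(\cdot)}(f)=\int_\Omega|f(x)|^{q(x)}\,d\mu(x)$. The space $L^{q(\cdot)}(\Omega)$ is the set of all measurable functions $f$ on $\Omega$ such that $\varrho_{q(\cdot)}(\lambda f)<\infty$ for some $\lambda>0$, equipped with the Luxemburg norm $$\|f\|_{q(\cdot)}=\inf\{\lambda>0:\varrho_{q(\cdot)}(f/\lambda)\le1\}.$$ Grand variable exponent Lebesgue space: for $\theta>0$, $L^{p(\cdot),\theta}(\Omega)$ is the class of all measurable functions $f$ on $\Omega$ for which $$\|f\|_{p(\cdot),\theta}=\sup_{0<\varepsilon<p^--1}\varepsilon^{\frac{\theta}{p^--\varepsilon}}\,\|f\|_{p(\cdot)-\varepsilon}<\infty,$$ where $p(\cdot)-\varepsilon$ denotes the exponent $x\mapsto p(x)-\varepsilon$. $C_0^\infty(\Omega)$ is the space of smooth functions with compact support in $\Omega$, and $[L^{p(\cdot)}(\Omega)]_{p(\cdot),\theta}$ denotes the closure of $C_0^\infty(\Omega)$ in $L^{p(\cdot),\theta}(\Omega)$ with respect to the norm $\|\cdot\|_{p(\cdot),\theta}$. It is also stated in the source that this closure is the set $$\left\{f\in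 L^{p(\cdot),\theta}(\Omega):\ \lim_{\varepsilon\to0}\varepsilon^{\frac{\theta}{p^--\varepsilon}}\|f\|_{p(\cdot)-\varepsilon}=0\right\}.$$ A measurable map $T:\Omega\to\Omega$ is a measure-preserving transformation if $\mu(T^{-1}(A))=\mu(A)$ for all $A\in\Sigma$. $T^j$ is the $j$-fold iterate of $T$, with $T^0$ the identity.
   Formalization: The condition 1 ≤ p^- is replaced by 1 < p^-: if p^- = 1 the supremum defining the norm is over the empty set, every measurable function lies in the space, and (i) fails (p = 1, shift on i.i.d. Cauchy variables). *)

theory Defs
  imports "HOL-Probability.Probability"
begin

definition ess_inf :: "'a measure \<Rightarrow> ('a \<Rightarrow> real) \<Rightarrow> ereal" where
  "ess_inf M p = - esssup M (\<lambda>x. - ereal (p x))"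

text \<open>The value \<open>p\<^sup>-\<close> as a real number; the conversion from \<^typ>\<open>ereal\<close> loses nothing when \<open>p\<close>
  is a real-valued measurable function on a probability space that is bounded below.\<close>

definition p_minus :: "'a measure \<Rightarrow> ('a \<Rightarrow> real) \<Rightarrow> real" where
  "p_minus M p = real_of_ereal (ess_inf M p)"

definition p_plus :: "'a measure \<Rightarrow> ('a \<Rightarrow> real) \<Rightarrow> ereal" where
  "p_plus M p = esssup M (\<lambda>x. ereal (p x))"

definition modular :: "'a measure \<Rightarrow> ('a \<Rightarrow> real) \<Rightarrow> ('a \<Rightarrow> real) \<Rightarrow> ennreal" where
  "modular M q f = (\<integral>\<^sup>+ x. ennreal (\<bar>f x\<bar> powr q x) \<partial>M)"

text \<open>The norms take values in \<^typ>\<open>ennreal\<close>. For measurable \<open>f\<close> and \<open>1 \<le> q\<^sup>- \<le> q\<^sup>+ < \<infinity>\<close>,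
  the Luxemburg norm is infinite (infimum of the empty set) exactly when \<open>f\<close> is not in \<open>L\<^sup>q\<close>.\<close>

definition lux_norm :: "'a measure \<Rightarrow> ('a \<Rightarrow> real) \<Rightarrow> ('a \<Rightarrow> real) \<Rightarrow> ennreal" where
  "lux_norm M q f = (INF l\<in>{l::real. 0 < l \<and> modular M q (\<lambda>x. f x / l) \<le> 1}. ennreal l)"

definition grand_term ::
  "'a measure \<Rightarrow> ('a \<Rightarrow> real) \<Rightarrow> real \<Rightarrow> ('a \<Rightarrow> real) \<Rightarrow> real \<Rightarrow> ennreal" where
  "grand_term M p \<theta> f \<epsilon> =
     ennreal (\<epsilon> powr (\<theta> / (p_minus M p - \<epsilon>))) * lux_norm M (\<lambda>x. p x - \<epsilon>) f"

definition grand_norm ::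
  "'a measure \<Rightarrow> ('a \<Rightarrow> real) \<Rightarrow> real \<Rightarrow> ('a \<Rightarrow> real) \<Rightarrow> ennreal" where
  "grand_norm M p \<theta> f = (SUP \<epsilon>\<in>{0<..<p_minus M p - 1}. grand_term M p \<theta> f \<epsilon>)"

definition grand_space :: "'a measure \<Rightarrow> ('a \<Rightarrow> real) \<Rightarrow> real \<Rightarrow> ('a \<Rightarrow> real) set" where
  "grand_space M p \<theta> = {f \<in> borel_measurable M. grand_norm M p \<theta> f < \<infinity>}"

text \<open>If \<open>p\<^sup>- = 1\<close> the supremum is over the empty set, so the grand norm vanishes identically and
  the grand space consists of all measurable functions, integrable or not.\<close>

lemma grand_space_degenerate:
  assumes "p_minus M p \<le> 1"
  shows "grand_space M p \<theta> = borel_measurable M"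
proof -
  have "{0<..<p_minus M p - 1} = {}" using assms by auto
  then show ?thesis by (simp add: grand_space_def grand_norm_def bot_ennreal)
qed

definition grand_vanishing :: "'a measure \<Rightarrow> ('a \<Rightarrow> real) \<Rightarrow> real \<Rightarrow> ('a \<Rightarrow> real) set" where
  "grand_vanishing M p \<theta> =
     {f \<in> grand_space M p \<theta>. (grand_term M p \<theta> f \<longlongrightarrow> 0) (at_right 0)}"

definition grand_closure ::
  "'a measure \<Rightarrow> ('a \<Rightarrow> real) \<Rightarrow> real \<Rightarrow> ('a \<Rightarrow> real) set \<Rightarrow> ('a \<Rightarrow> real) set" where
  "grand_closure M p \<theta> D =
     {f \<in> grand_space M p \<theta>. \<forall>e::real. 0 < e \<longrightarrow>
        (\<exists>g \<in> D \<inter> grand_space M p \<theta>. grand_norm M p \<theta> (\<lambda>x. f x - g x) < ennreal e)}"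

text \<open>\<open>C\<^sup>k\<close> on the whole space: \<open>Ck (Suc k) g\<close> asks that \<open>g\<close> is differentiable and that
  every directional derivative of \<open>g\<close> is \<open>C\<^sup>k\<close>.\<close>

primrec Ck :: "nat \<Rightarrow> ('e::euclidean_space \<Rightarrow> real) \<Rightarrow> bool" where
  "Ck 0 g \<longleftrightarrow> continuous_on UNIV g"
| "Ck (Suc k) g \<longleftrightarrow>
     (\<forall>x. g differentiable (at x)) \<and> (\<forall>v. Ck k (\<lambda>x. frechet_derivative g (at x) v))"

text \<open>The space \<open>C\<^sub>0\<^sup>\<infinity>(\<Omega>)\<close> presupposes that \<open>\<Omega>\<close> is an open subset of a Euclidean space whose Borel
  sets are measurable. On an abstract sample space this is expressed by an injection \<open>\<phi>\<close> that
  identifies \<open>\<Omega>\<close> with such a subset. If \<open>\<Omega>\<close> already is one, \<open>\<phi>\<close> is the identity. A smooth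
  function with compact support in \<open>\<phi>(\<Omega>)\<close> is given by its extension by zero.\<close>

definition euclidean_domain :: "'a measure \<Rightarrow> ('a \<Rightarrow> 'e::euclidean_space) \<Rightarrow> bool" where
  "euclidean_domain M \<phi> \<longleftrightarrow>
     \<phi> \<in> borel_measurable M \<and> inj_on \<phi> (space M) \<and> open (\<phi> ` space M)"

definition test_functions :: "'a measure \<Rightarrow> ('a \<Rightarrow> 'e::euclidean_space) \<Rightarrow> ('a \<Rightarrow> real) set" where
  "test_functions M \<phi> =
     {h. \<exists>g. (\<forall>k. Ck k g) \<and> compact (closure {y. g y \<noteq> 0}) \<and>
         closure {y. g y \<noteq> 0} \<subseteq> \<phi> ` space M \<and> (\<forall>x\<in>space M. h x = g (\<phi> x))}"

definition measure_preserving :: "'a measure \<Rightarrow> ('a \<Rightarrow> 'a) \<Rightarrow> bool" where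
  "measure_preserving M T \<longleftrightarrow>
     T \<in> measurable M M \<and> (\<forall>A\<in>sets M. emeasure M (T -` A \<inter> space M) = emeasure M A)"

definition ergodic_avg :: "('a \<Rightarrow> 'a) \<Rightarrow> ('a \<Rightarrow> real) \<Rightarrow> nat \<Rightarrow> 'a \<Rightarrow> real" where
  "ergodic_avg T f n x = (1 / real n) * (\<Sum>j<n. f ((T ^^ j) x))"

text \<open>Only meaningful at points where the averages converge.\<close>

definition f_av :: "('a \<Rightarrow> 'a) \<Rightarrow> ('a \<Rightarrow> real) \<Rightarrow> 'a \<Rightarrow> real" where
  "f_av T f x = lim (\<lambda>n. ergodic_avg T f n x)"

end

theory Submission
  imports Defs
begin

text \<open>Birkhoff's theorem: put \<open>h = f - E[f | I] - e\<close>, where \<open>I\<close> is the invariant sigma-algebra. The set \<open>E\<close>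
  where the sums of \<open>h\<close> along the orbit are unbounded above is invariant, and comparing the maximal sums
  at \<open>x\<close> and \<open>T x\<close> gives \<open>0 \<le> \<integral>\<^sub>E h = - e \<cdot> \<mu> E\<close>; hence the averages of \<open>f\<close> are asymptotically at most
  \<open>E[f | I] + e\<close>. The same for \<open>- f\<close> gives convergence to \<open>E[f | I]\<close>.

  Since the exponent \<open>q\<close> is invariant, convexity of \<open>t \<mapsto> t powr q x\<close> shows pointwise that
  \<open>\<bar>A\<^sub>n f\<bar>\<^sup>q \<le> A\<^sub>n (\<bar>f\<bar>\<^sup>q)\<close>. So the averages are contractions for every Luxemburg norm, and the
  right-hand side, which converges together with its integrals by Birkhoff's theorem, serves as a varying
  dominating sequence for norm convergence. In the grand norm the terms with small \<open>\<epsilon>\<close> are bounded by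
  those of \<open>f\<close>, which vanish in the limit, and the terms with \<open>\<epsilon> \<ge> d\<close> by the norm with exponent \<open>p - d\<close>.\<close>

section \<open>Birkhoff's ergodic theorem\<close>

locale measure_preserving_system = prob_space M for M :: "'a measure" +
  fixes T :: "'a \<Rightarrow> 'a"
  assumes mp: "measure_preserving M T"
begin

section \<open>Iterates of the transformation and invariance of integrals\<close>

lemma T_measurable [measurable]: "T \<in> measurable M M"
  using mp by (simp add: measure_preserving_def)

lemma iterate_measurable [measurable]: "(T ^^ n) \<in> measurable M M"
proof (induction n)
  case (Suc n)
  then show ?case using measurable_comp[OF Suc T_measurable] by simp
qed (simp add: id_def)

lemma iterate_in_space: "x \<in> space M \<Longrightarrow> (T ^^ n) x \<in> space M"
  using measurable_space[OF iterate_measurable] .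

lemma distr_T: "distr M M T = M"
  by (rule measure_eqI) (use mp in \<open>auto simp: emeasure_distr measure_preserving_def\<close>)

lemma distr_iterate: "distr M M (T ^^ n) = M"
proof (induction n)
  case 0
  then show ?case by (simp add: id_def)
next
  case (Suc n)
  have "distr M M (T ^^ Suc n) = distr (distr M M (T ^^ n)) M T"
    by (subst distr_distr) simp_all
  also have "\<dots> = M" by (simp only: Suc distr_T)
  finally show ?case .
qed

lemma nn_integral_iterate:
  "g \<in> borel_measurable M \<Longrightarrow> (\<integral>\<^sup>+ x. g ((T ^^ n) x) \<partial>M) = (\<integral>\<^sup>+ x. g x \<partial>M)"
  using nn_integral_distr[OF iterate_measurable, of g n] by (simp add: distr_iterate)

lemma integrable_iterate:
  fixes g :: "'a \<Rightarrow> real"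
  shows "integrable M g \<Longrightarrow> integrable M (\<lambda>x. g ((T ^^ n) x))"
  using integrable_distr[OF iterate_measurable[of n], of g] by (simp add: distr_iterate)

lemma integral_iterate:
  fixes g :: "'a \<Rightarrow> real"
  shows "g \<in> borel_measurable M \<Longrightarrow> (\<integral> x. g ((T ^^ n) x) \<partial>M) = (\<integral> x. g x \<partial>M)"
  using integral_distr[OF iterate_measurable, of g n] by (simp add: distr_iterate)

section \<open>The sigma-algebra of invariant sets\<close>

definition inv_alg :: "'a measure" where
  "inv_alg = sigma (space M) {A \<in> sets M. T -` A \<inter> space M = A}"

lemma space_inv_alg [simp]: "space inv_alg = space M"
  unfolding inv_alg_def by (rule space_measure_of) (auto dest: sets.sets_into_space)

text \<open>The generating family is already a sigma-algebra, so \<open>sigma\<close> adds no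
  sets.\<close>

lemma sets_inv_alg: "sets inv_alg = {A \<in> sets M. T -` A \<inter> space M = A}"
proof -
  have "sigma_algebra (space M) {A \<in> sets M. T -` A \<inter> space M = A}"
    unfolding sigma_algebra_iff2
  proof (intro conjI ballI allI impI)
    show "{A \<in> sets M. T -` A \<inter> space M = A} \<subseteq> Pow (space M)"
      using sets.sets_into_space by blast
    show "space M - A \<in> {A \<in> sets M. T -` A \<inter> space M = A}"
      if "A \<in> {A \<in> sets M. T -` A \<inter> space M = A}" for A
      using that measurable_space[OF T_measurable] by blast
    show "(\<Union>i::nat. A i) \<in> {A \<in> sets M. T -` A \<inter> space M = A}"
      if "range A \<subseteq> {A \<in> sets M. T -` A \<inter> space M = A}" for A
    proof -
      have "A i \<in> sets M" "T -` A i \<inter> space M = A i" for i using that by auto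
      moreover have "T -` (\<Union>i. A i) \<inter> space M = (\<Union>i. T -` A i \<inter> space M)" by auto
      ultimately show ?thesis by auto
    qed
  qed simp
  then show ?thesis
    unfolding inv_alg_def by (rule sigma_algebra.sets_measure_of_eq)
qed

lemma subalgebra_inv_alg: "subalgebra M inv_alg"
  by (auto simp: subalgebra_def sets_inv_alg)

sublocale I: finite_measure_subalgebra M inv_alg
  by unfold_locales (rule subalgebra_inv_alg)

text \<open>The level set of \<open>g\<close> through \<open>y\<close> equals its own preimage under
  \<open>T\<close>, so it contains \<open>T y\<close> together with \<open>y\<close>. As the sets of
  \<open>inv_alg\<close> are strictly invariant, not just modulo null sets, the conclusion holds at
  every point.\<close>

lemma inv_alg_measurable_invariant:
  fixes g :: "'a \<Rightarrow> real"
  assumes "g \<in> borel_measurable inv_alg" "x \<in> space M"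
  shows "g ((T ^^ n) x) = g x"
proof -
  have step: "g (T y) = g y" if "y \<in> space M" for y
  proof -
    have "g -` {g y} \<inter> space M \<in> sets inv_alg"
      using measurable_sets[OF assms(1), of "{g y}"] by simp
    then have "T -` (g -` {g y} \<inter> space M) \<inter> space M = g -` {g y} \<inter> space M"
      by (simp add: sets_inv_alg)
    with that show ?thesis by blast
  qed
  show ?thesis
    using assms(2) step[OF iterate_in_space] by (induction n) auto
qed

section \<open>Orbit sums, maximal sums and the maximal inequality\<close>

definition bsum :: "('a \<Rightarrow> real) \<Rightarrow> nat \<Rightarrow> 'a \<Rightarrow> real" where
  "bsum f n x = (\<Sum>j<n. f ((T ^^ j) x))"

lemma ergodic_avg_bsum: "ergodic_avg T f n x = bsum f n x / real n"
  by (simp add: ergodic_avg_def bsum_def)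

lemma bsum_Suc: "bsum f (Suc n) x = f x + bsum f n (T x)"
  unfolding bsum_def by (subst sum.lessThan_Suc_shift) (simp add: funpow_Suc_right del: funpow.simps)

lemma bsum_measurable [measurable]: "f \<in> borel_measurable M \<Longrightarrow> bsum f n \<in> borel_measurable M"
  unfolding bsum_def[abs_def]
  by (intro borel_measurable_sum measurable_compose[OF iterate_measurable])

text \<open>\<open>maxsum f n\<close> is the maximum of the sums \<open>bsum f k\<close> over \<open>1 \<le> k \<le> n + 1\<close>.\<close>

primrec maxsum :: "('a \<Rightarrow> real) \<Rightarrow> nat \<Rightarrow> 'a \<Rightarrow> real" where
  "maxsum f 0 x = f x"
| "maxsum f (Suc n) x = f x + max 0 (maxsum f n (T x))"

lemma maxsum_measurable [measurable]: "f \<in> borel_measurable M \<Longrightarrow> maxsum f n \<in> borel_measurable M"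
proof (induction n)
  case (Suc n)
  have [measurable]: "maxsum f n \<in> borel_measurable M" "f \<in> borel_measurable M" using Suc by auto
  show ?case unfolding maxsum.simps[abs_def] by measurable
qed (simp add: fun_eq_iff[symmetric] maxsum.simps[abs_def])

lemma maxsum_integrable: "integrable M f \<Longrightarrow> integrable M (maxsum f n)"
proof (induction n)
  case (Suc n)
  have "integrable M (\<lambda>x. maxsum f n ((T ^^ 1) x))"
    using Suc by (intro integrable_iterate) auto
  then show ?case using Suc.prems unfolding maxsum.simps[abs_def] by auto
qed (simp add: maxsum.simps[abs_def])

lemma maxsum_mono: "maxsum f n x \<le> maxsum f (Suc n) x"
proof (induction n arbitrary: x)
  case (Suc n)
  from Suc[of "T x"] have "max 0 (maxsum f n (T x)) \<le> max 0 (maxsum f (Suc n) (T x))"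
    by (intro max.mono) auto
  then show ?case by (subst (1 2) maxsum.simps(2)) (rule add_left_mono)
qed simp

text \<open>Induction along the orbit: a sum of length at least 2 at \<open>x\<close> is
  \<open>f x\<close> plus a shorter sum at \<open>T x\<close>, which the maximal sum at
  \<open>T x\<close> dominates.\<close>

lemma maxsum_ge_bsum: "k \<le> n \<Longrightarrow> bsum f (Suc k) x \<le> maxsum f n x"
proof (induction n arbitrary: k x)
  case 0
  then show ?case by (simp add: bsum_def)
next
  case (Suc n)
  show ?case
  proof (cases k)
    case 0
    then show ?thesis by (simp add: bsum_def)
  next
    case (Suc k')
    then have "bsum f (Suc k') (T x) \<le> maxsum f n (T x)"
      using Suc.IH Suc.prems by simp
    then show ?thesis using Suc by (simp add: bsum_Suc[of f "Suc k'"])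
  qed
qed

text \<open>The bounds are natural numbers, which makes membership a countable combination of
  measurable conditions.\<close>

definition unbounded_sums :: "('a \<Rightarrow> real) \<Rightarrow> 'a set" where
  "unbounded_sums f = {x \<in> space M. \<forall>B::nat. \<exists>n. real B < bsum f n x}"

text \<open>Sums at \<open>x\<close> and at \<open>T x\<close> differ by \<open>f x\<close> and a
  shift of the length. Raising the bound by a natural number above \<open>\<bar>f x\<bar>\<close>
  absorbs this difference in both directions.\<close>

lemma unbounded_sums_invariant:
  assumes [measurable]: "f \<in> borel_measurable M"
  shows "unbounded_sums f \<in> sets inv_alg"
proof -
  have "unbounded_sums f \<in> sets M" unfolding unbounded_sums_def by measurable
  moreover have "T x \<in> unbounded_sums f \<longleftrightarrow> x \<in> unbounded_sums f" if x: "x \<in> space M" for x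
  proof -
    have "(\<forall>B::nat. \<exists>n. real B < bsum f n (T x)) \<longleftrightarrow> (\<forall>B::nat. \<exists>n. real B < bsum f n x)"
    proof safe
      fix B :: nat assume "\<forall>B::nat. \<exists>n. real B < bsum f n (T x)"
      then obtain n where "real (B + nat \<lceil>\<bar>f x\<bar>\<rceil>) < bsum f n (T x)" by blast
      then have "real B < bsum f (Suc n) x" unfolding bsum_Suc by (simp; linarith)
      then show "\<exists>n. real B < bsum f n x" by blast
    next
      fix B :: nat assume "\<forall>B::nat. \<exists>n. real B < bsum f n x"
      then obtain n where n: "real (B + nat \<lceil>\<bar>f x\<bar>\<rceil>) < bsum f n x" by blast
      \<comment> \<open>The empty sum is 0 and cannot exceed a nonnegative bound, so
        \<open>n\<close> is positive.\<close>
      then obtain m where "n = Suc m" by (cases n) (auto simp: bsum_def; linarith)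
      with n have "real B < bsum f m (T x)" by (simp add: bsum_Suc; linarith)
      then show "\<exists>n. real B < bsum f n (T x)" by blast
    qed
    then show ?thesis using x measurable_space[OF T_measurable] by (auto simp: unbounded_sums_def)
  qed
  moreover have "unbounded_sums f \<subseteq> space M" by (auto simp: unbounded_sums_def)
  ultimately show ?thesis by (auto simp: sets_inv_alg)
qed

text \<open>On \<open>unbounded_sums f\<close> the differences \<open>maxsum f (n + 1) x - maxsum f n (T x)\<close> are eventually equal to
  \<open>f x\<close>, while their integral over this invariant set equals that of \<open>maxsum f (n + 1) - maxsum f n\<close>.\<close>

lemma integral_unbounded_sums_nonneg:
  assumes f: "integrable M f"
  shows "0 \<le> (\<integral>x\<in>unbounded_sums f. f x \<partial>M)"
proof -
  let ?E = "unbounded_sums f"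
  have [measurable]: "f \<in> borel_measurable M" using f by auto
  have inv: "?E \<in> sets M" "T -` ?E \<inter> space M = ?E"
    using unbounded_sums_invariant[of f] by (auto simp: sets_inv_alg)
  have [measurable]: "?E \<in> sets M" by (fact inv(1))
  let ?d = "\<lambda>n x. indicator ?E x * (maxsum f (Suc n) x - maxsum f n (T x))"
  have intT: "integrable M (\<lambda>x. maxsum f n (T x))" for n
    using integrable_iterate[OF maxsum_integrable[OF f, of n], of 1] by simp
  have fT: "integrable M (\<lambda>x. f (T x))"
    using integrable_iterate[OF f, of 1] by simp
  have ind: "integrable M (\<lambda>x. indicator ?E x * g x)" if "integrable M g" for g :: "'a \<Rightarrow> real"
    using integrable_mult_indicator[OF inv(1) that] by simp
  have nonneg: "0 \<le> (\<integral>x. ?d n x \<partial>M)" for n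
  proof -
    \<comment> \<open>By invariance of \<open>?E\<close> the indicator may be evaluated at
      \<open>T x\<close> as well; the integrand is then a function composed with \<open>T\<close>,
      written \<open>T ^^ 1\<close> to match \<open>integral_iterate\<close>.\<close>
    have "(\<integral>x. indicator ?E x * maxsum f n (T x) \<partial>M)
        = (\<integral>x. indicator ?E ((T ^^ 1) x) * maxsum f n ((T ^^ 1) x) \<partial>M)"
      using inv(2) by (intro Bochner_Integration.integral_cong) (auto split: split_indicator)
    also have "\<dots> = (\<integral>x. indicator ?E x * maxsum f n x \<partial>M)"
      by (rule integral_iterate) measurable
    also have "\<dots> \<le> (\<integral>x. indicator ?E x * maxsum f (Suc n) x \<partial>M)"
      using maxsum_mono[of f n]
      by (intro integral_mono ind maxsum_integrable f) (auto split: split_indicator)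
    finally show ?thesis
      using Bochner_Integration.integral_diff[OF ind[OF maxsum_integrable[OF f, of "Suc n"]] ind[OF intT[of n]]]
      unfolding right_diff_distrib by linarith
  qed
  have "(\<lambda>n. \<integral>x. ?d n x \<partial>M) \<longlonglongrightarrow> (\<integral>x. indicator ?E x * f x \<partial>M)"
  proof (rule integral_dominated_convergence[where w = "\<lambda>x. \<bar>f x\<bar> + \<bar>f (T x)\<bar>"])
    show "AE x in M. (\<lambda>n. ?d n x) \<longlonglongrightarrow> indicator ?E x * f x"
    proof (rule AE_I2, cases)
      fix x assume x: "x \<in> space M" "x \<in> ?E"
      \<comment> \<open>Since \<open>T x\<close> also has unbounded sums, some sum there is
        positive. From then on the maximum with 0 in \<open>maxsum\<close> is inactive and
        \<open>?d n x\<close> is exactly \<open>f x\<close>.\<close>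
      then have "T x \<in> ?E" using inv(2) by blast
      then obtain m where m: "real 0 < bsum f m (T x)" unfolding unbounded_sums_def by blast
      then obtain k where k: "m = Suc k" by (cases m) (auto simp: bsum_def)
      have "?d n x = indicator ?E x * f x" if "k \<le> n" for n
      proof -
        have "0 < maxsum f n (T x)" using maxsum_ge_bsum[OF that, of f "T x"] m k by simp
        then show ?thesis by simp
      qed
      then show "(\<lambda>n. ?d n x) \<longlonglongrightarrow> indicator ?E x * f x"
        by (intro tendsto_eventually) (auto simp: eventually_sequentially)
    qed auto
    show "AE x in M. norm (?d n x) \<le> \<bar>f x\<bar> + \<bar>f (T x)\<bar>" for n
    proof (rule AE_I2)
      fix x
      \<comment> \<open>With \<open>m = maxsum f n (T x)\<close> the difference is
        \<open>f x + max 0 (- m)\<close>, and \<open>m \<ge> f (T x)\<close> bounds the second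
        summand by \<open>\<bar>f (T x)\<bar>\<close> for all \<open>n\<close>.\<close>
      have "f (T x) \<le> maxsum f n (T x)" using maxsum_ge_bsum[of 0 n f "T x"] by (simp add: bsum_def)
      then have "\<bar>f x + max 0 (maxsum f n (T x)) - maxsum f n (T x)\<bar> \<le> \<bar>f x\<bar> + \<bar>f (T x)\<bar>" by linarith
      then show "norm (?d n x) \<le> \<bar>f x\<bar> + \<bar>f (T x)\<bar>" by (cases "x \<in> ?E") simp_all
    qed
  qed (use f fT in auto)
  then have "0 \<le> (\<integral>x. indicator ?E x * f x \<partial>M)"
    by (rule LIMSEQ_le_const) (use nonneg in auto)
  then show ?thesis by (simp add: set_lebesgue_integral_def)
qed

section \<open>Almost everywhere convergence of the averages\<close>

lemma bsum_upper:
  assumes f: "integrable M f" and e: "0 < e"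
  shows "AE x in M. \<exists>B. \<forall>n. bsum f n x \<le> real n * (real_cond_exp M inv_alg f x + e) + B"
proof -
  let ?c = "real_cond_exp M inv_alg f"
  define h where "h x = f x - (?c x + e)" for x
  have c: "integrable M ?c" using I.real_cond_exp_int(1)[OF f] .
  have h: "integrable M h" unfolding h_def using f c by auto
  let ?E = "unbounded_sums h"
  have E: "?E \<in> sets inv_alg" using unbounded_sums_invariant h by auto
  then have EM [measurable]: "?E \<in> sets M" by (simp add: sets_inv_alg)
  have ind: "integrable M (\<lambda>x. indicator ?E x * g x)" if "integrable M g" for g :: "'a \<Rightarrow> real"
    using integrable_mult_indicator[OF EM that] by simp
  have "0 \<le> (\<integral>x\<in>?E. h x \<partial>M)" by (rule integral_unbounded_sums_nonneg[OF h])
  also have "\<dots> = (\<integral>x. indicator ?E x * f x - indicator ?E x * ?c x - indicator ?E x * e \<partial>M)"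
    unfolding set_lebesgue_integral_def h_def by (simp add: algebra_simps)
  also have "\<dots> = (\<integral>x\<in>?E. f x \<partial>M) - (\<integral>x\<in>?E. ?c x \<partial>M) - e * prob ?E"
    unfolding set_lebesgue_integral_def
    using ind[OF f] ind[OF c] ind[of "\<lambda>_. e"]
    by (simp add: mult.commute)
  \<comment> \<open>Over an invariant set \<open>f\<close> and its conditional expectation have the
    same integral and cancel.\<close>
  also have "\<dots> = - e * prob ?E" using I.real_cond_exp_intA[OF f E] by simp
  finally have "prob ?E = 0" using e measure_nonneg[of M ?E] by (simp add: mult_le_0_iff)
  then have "AE x in M. x \<notin> ?E" by (intro AE_not_in) (auto simp: null_sets_def emeasure_eq_measure)
  then show ?thesis using AE_space
  proof eventually_elim
    fix x assume x: "x \<notin> ?E" "x \<in> space M"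
    then obtain B :: nat where B: "\<forall>n. bsum h n x \<le> real B" by (auto simp: unbounded_sums_def not_less)
    \<comment> \<open>The conditional expectation is constant along the orbit, so its sum is
      \<open>n\<close> times its value at \<open>x\<close>.\<close>
    have "bsum h n x = bsum f n x - real n * (?c x + e)" for n
      unfolding bsum_def h_def
      using inv_alg_measurable_invariant[OF borel_measurable_cond_exp x(2)]
      by (simp add: sum_subtractf)
    with B show "\<exists>B. \<forall>n. bsum f n x \<le> real n * (?c x + e) + B"
      by (intro exI[of _ "real B"]) (simp add: algebra_simps)
  qed
qed

text \<open>Division by \<open>n\<close> removes the constant \<open>B\<close>. One null set has to
  serve all \<open>e\<close>, so \<open>bsum_upper\<close> is applied to the countably many values
  \<open>1 / Suc k\<close> only.\<close>

lemma avg_upper: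
  assumes f: "integrable M f"
  shows "AE x in M. \<forall>e>0. \<forall>\<^sub>F n in sequentially. ergodic_avg T f n x \<le> real_cond_exp M inv_alg f x + e"
proof -
  have "AE x in M. \<forall>k::nat. \<exists>B. \<forall>n. bsum f n x \<le> real n * (real_cond_exp M inv_alg f x + 1 / Suc k) + B"
    unfolding AE_all_countable using bsum_upper[OF f] by simp
  then show ?thesis
  proof (eventually_elim, safe)
    fix x and e :: real
    let ?c = "real_cond_exp M inv_alg f x"
    assume *: "\<forall>k::nat. \<exists>B. \<forall>n. bsum f n x \<le> real n * (?c + 1 / Suc k) + B" and e: "e > 0"
    obtain k where k: "1 / Suc k < e" using nat_approx_posE[OF e] by auto
    from * obtain B where B: "bsum f n x \<le> real n * (?c + 1 / Suc k) + B" for n by meson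
    have "(\<lambda>n. ?c + 1 / Suc k + B / real n) \<longlonglongrightarrow> ?c + 1 / Suc k + 0"
      by (intro tendsto_intros lim_const_over_n)
    then have "\<forall>\<^sub>F n in sequentially. ?c + 1 / Suc k + B / real n < ?c + e"
      by (rule order_tendstoD) (use k in simp)
    then show "\<forall>\<^sub>F n in sequentially. ergodic_avg T f n x \<le> ?c + e"
      using eventually_gt_at_top[of 0]
    proof eventually_elim
      case (elim n)
      have "ergodic_avg T f n x \<le> (real n * (?c + 1 / Suc k) + B) / real n"
        unfolding ergodic_avg_bsum using B[of n] elim by (intro divide_right_mono) auto
      also have "\<dots> = ?c + 1 / Suc k + B / real n"
        using elim by (simp add: add_divide_distrib)
      finally show ?case using elim by simp
    qed
  qed
qed

theorem birkhoff:
  assumes f: "integrable M f"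
  shows "AE x in M. (\<lambda>n. ergodic_avg T f n x) \<longlonglongrightarrow> real_cond_exp M inv_alg f x"
proof -
  have m: "integrable M (\<lambda>x. - f x)" using f by simp
  \<comment> \<open>This turns the upper bound for \<open>- f\<close> into a lower bound for
    \<open>f\<close>.\<close>
  have "AE x in M. real_cond_exp M inv_alg (\<lambda>x. - 1 * f x) x = - 1 * real_cond_exp M inv_alg f x"
    by (rule I.real_cond_exp_cmult[OF f])
  with avg_upper[OF f] avg_upper[OF m] show ?thesis
  proof eventually_elim
    case (elim x)
    let ?c = "real_cond_exp M inv_alg f x"
    have neg: "ergodic_avg T (\<lambda>x. - f x) n x = - ergodic_avg T f n x" for n
      by (simp add: ergodic_avg_def sum_negf)
    show ?case
    proof (rule tendstoI)
      fix e :: real assume "0 < e"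
      then have "\<forall>\<^sub>F n in sequentially. ergodic_avg T f n x \<le> ?c + e/2"
          "\<forall>\<^sub>F n in sequentially. - ergodic_avg T f n x \<le> - ?c + e/2"
        using elim neg by auto
      then show "\<forall>\<^sub>F n in sequentially. dist (ergodic_avg T f n x) ?c < e"
        by eventually_elim (use \<open>0 < e\<close> in \<open>auto simp: dist_real_def abs_less_iff\<close>)
    qed
  qed
qed

section \<open>The limit function: measurability, integral and invariance\<close>

lemma f_av_cond_exp:
  assumes "integrable M f"
  shows "AE x in M. f_av T f x = real_cond_exp M inv_alg f x"
  using birkhoff[OF assms] by eventually_elim (simp add: f_av_def limI)

lemma ergodic_avg_tendsto_f_av:
  assumes "integrable M f"
  shows "AE x in M. (\<lambda>n. ergodic_avg T f n x) \<longlonglongrightarrow> f_av T f x"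
  using birkhoff[OF assms] f_av_cond_exp[OF assms] by eventually_elim simp

lemma ergodic_avg_measurable [measurable]:
  "f \<in> borel_measurable M \<Longrightarrow> ergodic_avg T f n \<in> borel_measurable M"
  unfolding ergodic_avg_bsum[abs_def] by (intro borel_measurable_divide bsum_measurable) auto

text \<open>\<open>lim\<close> takes one fixed value wherever the averages diverge, and the set of
  convergence is measurable, so integrability does not enter.\<close>

lemma f_av_measurable [measurable]:
  "f \<in> borel_measurable M \<Longrightarrow> f_av T f \<in> borel_measurable M"
  unfolding f_av_def[abs_def] by measurable

lemma integrable_ergodic_avg: "integrable M f \<Longrightarrow> integrable M (ergodic_avg T f n)"
  unfolding ergodic_avg_def[abs_def] using integrable_iterate[of f] by auto

text \<open>All \<open>n\<close> summands have the integral of \<open>f\<close>. For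
  \<open>n = 0\<close> the average is identically 0, which is why \<open>n\<close> must be
  positive.\<close>

lemma integral_ergodic_avg:
  assumes "integrable M f" "0 < n"
  shows "(\<integral>x. ergodic_avg T f n x \<partial>M) = (\<integral>x. f x \<partial>M)"
  unfolding ergodic_avg_def using assms integrable_iterate[of f]
  by (simp add: Bochner_Integration.integral_sum integral_iterate borel_measurable_integrable)

lemma integrable_f_av:
  assumes f: "integrable M f"
  shows "integrable M (f_av T f)"
  using I.real_cond_exp_int(1)[OF f] f_av_cond_exp[OF f]
  by (subst integrable_cong_AE[OF f_av_measurable[OF borel_measurable_integrable[OF f]]
        borel_measurable_cond_exp2])

lemma integral_f_av:
  assumes f: "integrable M f"
  shows "(\<integral>x. f_av T f x \<partial>M) = (\<integral>x. f x \<partial>M)"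
  using integral_cong_AE[OF f_av_measurable[OF borel_measurable_integrable[OF f]]
      borel_measurable_cond_exp2 f_av_cond_exp[OF f]] I.real_cond_exp_int(2)[OF f] by simp

text \<open>The average at \<open>T x\<close> is the next average at \<open>x\<close> times
  \<open>(n + 1) / n\<close>, minus \<open>f x / n\<close>. Both corrections vanish, so convergence
  at \<open>x\<close> entails convergence at \<open>T x\<close> to the same limit.\<close>

lemma f_av_invariant:
  assumes "integrable M f"
  shows "AE x in M. f_av T f x = f_av T f (T x)"
  using ergodic_avg_tendsto_f_av[OF assms]
proof eventually_elim
  case (elim x)
  have "(\<lambda>n. ergodic_avg T f (Suc n) x * (1 + 1 / real n) - f x / real n) \<longlonglongrightarrow> f_av T f x * (1 + 0) - 0"
    using elim by (intro tendsto_intros lim_const_over_n LIMSEQ_Suc)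
  moreover have "\<forall>\<^sub>F n in sequentially.
      ergodic_avg T f (Suc n) x * (1 + 1 / real n) - f x / real n = ergodic_avg T f n (T x)"
    using eventually_gt_at_top[of 0]
    proof eventually_elim
      case (elim n)
      have "ergodic_avg T f (Suc n) x * (1 + 1 / real n) = bsum f (Suc n) x / real n"
        using elim by (simp add: ergodic_avg_bsum divide_simps del: of_nat_Suc)
      then show ?case
        by (simp add: ergodic_avg_bsum bsum_Suc diff_divide_distrib[symmetric])
    qed
  ultimately have "(\<lambda>n. ergodic_avg T f n (T x)) \<longlonglongrightarrow> f_av T f x"
    by (subst (asm) filterlim_cong[OF refl refl]) auto
  then show ?case by (simp add: f_av_def limI)
qed

end

section \<open>Variable exponent Lebesgue spaces\<close>

lemma powr_convex_nonneg:
  fixes p :: real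
  assumes "1 \<le> p"
  shows "convex_on {0..} (\<lambda>x. x powr p)"
proof (rule convex_on_linorderI)
  fix t x y :: real
  assume t: "0 < t" "t < 1" and xy: "x \<in> {0..}" "y \<in> {0..}" "x < y"
  show "((1 - t) *\<^sub>R x + t *\<^sub>R y) powr p \<le> (1 - t) * x powr p + t * y powr p"
  proof (cases "x = 0")
    case True
    \<comment> \<open>With \<open>x = 0\<close> the claim is
      \<open>(t * y) powr p \<le> t * y powr p\<close>, which follows from
      \<open>t powr p \<le> t\<close>.\<close>
    have "t powr p \<le> t powr 1" using t assms by (intro powr_mono') auto
    then show ?thesis using True t by (simp add: powr_mult mult_right_mono)
  next
    case False
    then show ?thesis
      using convex_onD[OF powr_convex[OF assms], of t x y] t xy by auto
  qed
qed auto

text \<open>Triangle inequality, then Jensen's inequality with \<open>n\<close> equal weights. For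
  \<open>n = 0\<close> both sides are 0 because division by 0 gives 0.\<close>

lemma powr_abs_mean_le:
  fixes q :: real
  assumes "1 \<le> q"
  shows "\<bar>(\<Sum>j<n. a j) / real n\<bar> powr q \<le> (\<Sum>j<n. \<bar>a j\<bar> powr q) / real n"
proof (cases "n = 0")
  case False
  have "\<bar>(\<Sum>j<n. a j) / real n\<bar> \<le> (\<Sum>j<n. (1 / real n) *\<^sub>R \<bar>a j\<bar>)"
    using sum_abs[of a "{..<n}"] by (simp add: sum_divide_distrib[symmetric] divide_right_mono)
  then have "\<bar>(\<Sum>j<n. a j) / real n\<bar> powr q \<le> (\<Sum>j<n. (1 / real n) *\<^sub>R \<bar>a j\<bar>) powr q"
    using assms by (intro powr_mono2) auto
  also have "\<dots> \<le> (\<Sum>j<n. (1 / real n) * \<bar>a j\<bar> powr q)"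
    using False by (intro convex_on_sum[OF _ _ powr_convex_nonneg[OF assms]]) auto
  finally show ?thesis by (simp add: sum_divide_distrib)
qed simp

text \<open>The mean of the two numbers \<open>a\<close> and \<open>- b\<close>.\<close>

lemma powr_abs_half_diff_le:
  fixes q :: real
  assumes "1 \<le> q"
  shows "\<bar>(a - b) / 2\<bar> powr q \<le> (\<bar>a\<bar> powr q + \<bar>b\<bar> powr q) / 2"
  using powr_abs_mean_le[OF assms, where n = 2 and a = "\<lambda>j. if j = 0 then a else - b"]
  by (simp add: numeral_2_eq_2)

section \<open>Criteria for convergence to zero\<close>

lemma tendsto_0_ennrealI:
  fixes F :: "'b \<Rightarrow> ennreal"
  assumes "\<And>e::real. 0 < e \<Longrightarrow> \<forall>\<^sub>F n in G. F n \<le> ennreal e"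
  shows "(F \<longlongrightarrow> 0) G"
proof (rule order_tendstoI)
  fix a :: ennreal assume "0 < a"
  then obtain c where c: "0 < c" "c < a" using dense by blast
  then obtain e where "c = ennreal e" "0 < e" by (cases c) auto
  with assms[of e] c show "\<forall>\<^sub>F n in G. F n < a"
    by (auto elim: eventually_mono)
qed auto

text \<open>Pratt's lemma: split \<open>u n \<le> min (u n) w + (v n - w) + (w - v n)\<^sup>+\<close> and apply dominated
  convergence to the first and the last summand.\<close>

lemma integral_tendsto_0_generalized_dominated:
  fixes u v :: "nat \<Rightarrow> 'a \<Rightarrow> real"
  assumes u [measurable]: "\<And>n. u n \<in> borel_measurable M"
    and v: "\<And>n. integrable M (v n)" and w: "integrable M w"
    and u0: "\<And>n. AE x in M. 0 \<le> u n x" and uv: "\<And>n. AE x in M. u n x \<le> v n x"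
    and ulim: "AE x in M. (\<lambda>n. u n x) \<longlonglongrightarrow> 0"
    and vlim: "AE x in M. (\<lambda>n. v n x) \<longlonglongrightarrow> w x"
    and vint: "(\<lambda>n. \<integral>x. v n x \<partial>M) \<longlonglongrightarrow> (\<integral>x. w x \<partial>M)"
  shows "(\<lambda>n. \<integral>x. u n x \<partial>M) \<longlonglongrightarrow> 0"
proof -
  have [measurable]: "w \<in> borel_measurable M" "v n \<in> borel_measurable M" for n
    by (rule borel_measurable_integrable[OF w], rule borel_measurable_integrable[OF v])
  have "AE x in M. \<forall>n. 0 \<le> u n x" "AE x in M. \<forall>n. u n x \<le> v n x"
    using u0 uv by (simp_all only: AE_all_countable) blast+
  then have both: "AE x in M. (\<forall>n. 0 \<le> u n x) \<and> (\<forall>n. u n x \<le> v n x) \<and> 0 \<le> w x"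
    using vlim
  proof eventually_elim
    case (elim x)
    then have "0 \<le> v n x" for n using order_trans by blast
    with elim show ?case by (intro conjI LIMSEQ_le_const[of "\<lambda>n. v n x"]) auto
  qed
  have ui: "integrable M (u n)" for n
  proof (rule Bochner_Integration.integrable_bound[OF v[of n]])
    show "AE x in M. norm (u n x) \<le> norm (v n x)"
      using u0[of n] uv[of n] by eventually_elim simp
  qed (rule u)
  have mi: "integrable M (\<lambda>x. min (u n x) (w x))" for n
    using ui w by auto
  have pi: "integrable M (\<lambda>x. max 0 (w x - v n x))" for n
    using v w by auto
  have A: "(\<lambda>n. \<integral>x. min (u n x) (w x) \<partial>M) \<longlonglongrightarrow> integral\<^sup>L M (\<lambda>x. 0)"
  proof (rule integral_dominated_convergence[where w = w])
    show "AE x in M. (\<lambda>n. min (u n x) (w x)) \<longlonglongrightarrow> 0"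
      using both ulim
    proof eventually_elim
      case (elim x)
      have "(\<lambda>n. min (u n x) (w x)) \<longlonglongrightarrow> min 0 (w x)"
        using elim by (intro tendsto_intros) auto
      then show ?case using elim by simp
    qed
    show "AE x in M. norm (min (u n x) (w x)) \<le> w x" for n
      using both by eventually_elim auto
  qed (use w in auto)
  have B: "(\<lambda>n. \<integral>x. max 0 (w x - v n x) \<partial>M) \<longlonglongrightarrow> integral\<^sup>L M (\<lambda>x. 0)"
  proof (rule integral_dominated_convergence[where w = w])
    show "AE x in M. (\<lambda>n. max 0 (w x - v n x)) \<longlonglongrightarrow> 0"
      using vlim
    proof eventually_elim
      case (elim x)
      have "(\<lambda>n. max 0 (w x - v n x)) \<longlonglongrightarrow> max 0 (w x - w x)"
        using elim by (intro tendsto_intros) auto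
      then show ?case by simp
    qed
    \<comment> \<open>Since \<open>v n x\<close> is nonnegative, \<open>w x - v n x\<close> never
      exceeds \<open>w x\<close>.\<close>
    show "AE x in M. norm (max 0 (w x - v n x)) \<le> w x" for n
      using both
    proof eventually_elim
      case (elim x)
      then have "0 \<le> u n x" "u n x \<le> v n x" "0 \<le> w x" by blast+
      then show ?case by simp
    qed
  qed (use w in auto)
  have C: "(\<lambda>n. (\<integral>x. v n x \<partial>M) - (\<integral>x. w x \<partial>M)) \<longlonglongrightarrow> 0"
    using tendsto_diff[OF vint tendsto_const[of "\<integral>x. w x \<partial>M"]] by (simp only: diff_self)
  have bound: "(\<integral>x. u n x \<partial>M) \<le> (\<integral>x. min (u n x) (w x) \<partial>M)
      + ((\<integral>x. v n x \<partial>M) - (\<integral>x. w x \<partial>M)) + (\<integral>x. max 0 (w x - v n x) \<partial>M)" for n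
  proof -
    have "(\<integral>x. u n x \<partial>M) \<le> (\<integral>x. min (u n x) (w x) + (v n x - w x) + max 0 (w x - v n x) \<partial>M)"
    proof (rule integral_mono_AE[OF ui])
      \<comment> \<open>The last two summands add up to \<open>max 0 (v n x - w x)\<close>. Where
        \<open>u n x\<close> exceeds \<open>w x\<close>, this is at least
        \<open>u n x - w x\<close>.\<close>
      show "AE x in M. u n x \<le> min (u n x) (w x) + (v n x - w x) + max 0 (w x - v n x)"
        using both
      proof eventually_elim
        case (elim x)
        then have "u n x \<le> v n x" by blast
        then show ?case by (auto simp: min_def max_def)
      qed
    qed (intro Bochner_Integration.integrable_add Bochner_Integration.integrable_diff mi pi v w)
    also have "\<dots> = (\<integral>x. min (u n x) (w x) \<partial>M)
      + ((\<integral>x. v n x \<partial>M) - (\<integral>x. w x \<partial>M)) + (\<integral>x. max 0 (w x - v n x) \<partial>M)"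
      by (simp only: mi pi v w Bochner_Integration.integral_add Bochner_Integration.integral_diff
          Bochner_Integration.integrable_add Bochner_Integration.integrable_diff)
    finally show ?thesis .
  qed
  have "(\<lambda>n. (\<integral>x. min (u n x) (w x) \<partial>M)
      + ((\<integral>x. v n x \<partial>M) - (\<integral>x. w x \<partial>M)) + (\<integral>x. max 0 (w x - v n x) \<partial>M)) \<longlonglongrightarrow> 0 + 0 + 0"
    using A B C by (intro tendsto_add) simp_all
  then have lim: "(\<lambda>n. (\<integral>x. min (u n x) (w x) \<partial>M)
      + ((\<integral>x. v n x \<partial>M) - (\<integral>x. w x \<partial>M)) + (\<integral>x. max 0 (w x - v n x) \<partial>M)) \<longlonglongrightarrow> 0"
    by (simp only: add_0)
  show ?thesis
    by (rule tendsto_sandwich[OF always_eventually always_eventually tendsto_const lim])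
      (intro allI integral_nonneg_AE u0 bound)+
qed

section \<open>Modulars and the Luxemburg norm\<close>

lemma modular_antimono:
  assumes "AE x in M. 1 \<le> q x" "0 < k" "k \<le> l"
  shows "modular M q (\<lambda>x. f x / l) \<le> modular M q (\<lambda>x. f x / k)"
  unfolding modular_def
proof (rule nn_integral_mono_AE, use assms(1) in eventually_elim)
  fix x assume "1 \<le> q x"
  have "\<bar>f x / l\<bar> \<le> \<bar>f x / k\<bar>"
    using assms(2,3) by (simp add: frac_le)
  then show "ennreal (\<bar>f x / l\<bar> powr q x) \<le> ennreal (\<bar>f x / k\<bar> powr q x)"
    using \<open>1 \<le> q x\<close> by (intro ennreal_leI powr_mono2) simp_all
qed

text \<open>Convexity bounds the modular of half the difference by the mean of the two modulars. The
  resulting factor 2 is harmless, so this stands in for the sharp triangle inequality.\<close>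

lemma modular_half_diff:
  assumes [measurable]: "q \<in> borel_measurable M" "a \<in> borel_measurable M" "b \<in> borel_measurable M"
    and q: "AE x in M. 1 \<le> q x"
    and "modular M q (\<lambda>x. a x / l) \<le> 1" "modular M q (\<lambda>x. b x / l) \<le> 1"
  shows "modular M q (\<lambda>x. (a x - b x) / (2 * l)) \<le> 1"
proof -
  have "modular M q (\<lambda>x. (a x - b x) / (2 * l))
      \<le> (\<integral>\<^sup>+ x. ennreal (1/2) * (ennreal (\<bar>a x / l\<bar> powr q x) + ennreal (\<bar>b x / l\<bar> powr q x)) \<partial>M)"
    unfolding modular_def
  proof (rule nn_integral_mono_AE, use q in eventually_elim)
    fix x assume "1 \<le> q x"
    from powr_abs_half_diff_le[OF this, of "a x / l" "b x / l"]
    have "\<bar>(a x - b x) / (2 * l)\<bar> powr q x \<le> 1/2 * (\<bar>a x / l\<bar> powr q x + \<bar>b x / l\<bar> powr q x)"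
      by (simp add: diff_divide_distrib[symmetric] mult.commute)
    then show "ennreal (\<bar>(a x - b x) / (2 * l)\<bar> powr q x)
        \<le> ennreal (1/2) * (ennreal (\<bar>a x / l\<bar> powr q x) + ennreal (\<bar>b x / l\<bar> powr q x))"
      by (subst ennreal_plus[symmetric], simp, simp, subst ennreal_mult[symmetric])
        (simp_all only: ennreal_leI, auto)
  qed
  also have "\<dots> = ennreal (1/2) * (modular M q (\<lambda>x. a x / l) + modular M q (\<lambda>x. b x / l))"
    unfolding modular_def by (simp add: nn_integral_cmult nn_integral_add)
  also have "\<dots> \<le> ennreal (1/2) * (1 + 1)"
    using assms by (intro mult_left_mono add_mono) auto
  also have "\<dots> = 1"
  proof -
    have "(1 + 1 :: ennreal) = ennreal 2" by simp
    then show ?thesis by (simp only: flip: ennreal_mult') simp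
  qed
  finally show ?thesis .
qed

lemma lux_norm_le: "0 < l \<Longrightarrow> modular M q (\<lambda>x. f x / l) \<le> 1 \<Longrightarrow> lux_norm M q f \<le> ennreal l"
  unfolding lux_norm_def by (rule INF_lower) auto

lemma lux_norm_lessE:
  assumes "lux_norm M q f < c"
  obtains l where "0 < l" "modular M q (\<lambda>x. f x / l) \<le> 1" "ennreal l < c"
  using assms unfolding lux_norm_def INF_less_iff by auto

text \<open>A finite infimum \<open>L\<close> is approached by admissible \<open>l\<close> below
  \<open>L + e / C\<close>, and then \<open>C * l\<close> is at most \<open>C * L + e\<close>. If
  the norm is infinite, so is the right-hand side, as \<open>C\<close> is positive.\<close>

lemma lux_norm_greatest:
  assumes C: "0 < C"
    and le: "\<And>l. 0 < l \<Longrightarrow> modular M q (\<lambda>x. f x / l) \<le> 1 \<Longrightarrow> c \<le> ennreal (C * l)"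
  shows "c \<le> ennreal C * lux_norm M q f"
proof (cases "lux_norm M q f")
  case (real L)
  show ?thesis
  proof (rule ennreal_le_epsilon)
    fix e :: real assume e: "0 < e"
    have "lux_norm M q f < ennreal (L + e / C)"
      unfolding real using e C real by (intro ennreal_lessI) (auto intro: add_nonneg_pos)
    then obtain l where l: "0 < l" "modular M q (\<lambda>x. f x / l) \<le> 1" "ennreal l < ennreal (L + e / C)"
      by (rule lux_norm_lessE)
    then have "l \<le> L + e / C" by (simp add: ennreal_less_iff)
    then have "C * l \<le> C * L + e" using C by (simp add: field_simps)
    then have "c \<le> ennreal (C * L + e)"
      using le[OF l(1,2)] by (meson ennreal_leI order_trans)
    also have "\<dots> = ennreal C * lux_norm M q f + ennreal e"
      using C e real by (simp add: ennreal_mult)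
    finally show "c \<le> ennreal C * lux_norm M q f + ennreal e" .
  qed
qed (use C in \<open>simp add: ennreal_mult_top\<close>)

text \<open>If \<open>k\<close> is admissible for \<open>a\<close> and \<open>l\<close> for
  \<open>b\<close>, then \<open>k + l\<close> is admissible for both, and
  \<open>modular_half_diff\<close> applies at this common scale.\<close>

lemma lux_norm_diff_le:
  assumes [measurable]: "q \<in> borel_measurable M" "a \<in> borel_measurable M" "b \<in> borel_measurable M"
    and q: "AE x in M. 1 \<le> q x"
  shows "lux_norm M q (\<lambda>x. a x - b x) \<le> 2 * (lux_norm M q a + lux_norm M q b)"
proof (cases "lux_norm M q a + lux_norm M q b")
  case top
  have "2 * (lux_norm M q a + lux_norm M q b) = top"
    unfolding top by (simp add: ennreal_mult_top)
  then show ?thesis by (simp only: top_greatest)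
next
  case (real c)
  then have fin: "lux_norm M q a \<noteq> top" "lux_norm M q b \<noteq> top" by auto
  show ?thesis
  proof (rule ennreal_le_epsilon)
    fix e :: real assume e: "0 < e"
    \<comment> \<open>Two slacks of \<open>e/4\<close>, doubled by the factor 2, add up to
      \<open>e\<close>.\<close>
    have "lux_norm M q a < lux_norm M q a + ennreal (e/4)" "lux_norm M q b < lux_norm M q b + ennreal (e/4)"
      using e fin by (simp_all add: ennreal_add_left_cancel_less[of _ 0, simplified] less_top)
    then obtain k l where k: "0 < k" "modular M q (\<lambda>x. a x / k) \<le> 1" "ennreal k < lux_norm M q a + ennreal (e/4)"
      and l: "0 < l" "modular M q (\<lambda>x. b x / l) \<le> 1" "ennreal l < lux_norm M q b + ennreal (e/4)"
      by (metis lux_norm_lessE)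
    have "modular M q (\<lambda>x. a x / (k + l)) \<le> 1" "modular M q (\<lambda>x. b x / (k + l)) \<le> 1"
      using modular_antimono[OF q, of k "k + l" a] modular_antimono[OF q, of l "k + l" b] k l
      by (auto intro: order_trans)
    then have "lux_norm M q (\<lambda>x. a x - b x) \<le> ennreal (2 * (k + l))"
      using k l by (intro lux_norm_le modular_half_diff q) auto
    also have "\<dots> = 2 * (ennreal k + ennreal l)"
      using k l by (simp add: ennreal_mult)
    also have "\<dots> \<le> 2 * ((lux_norm M q a + ennreal (e/4)) + (lux_norm M q b + ennreal (e/4)))"
      using k l by (intro mult_left_mono add_mono) auto
    also have "\<dots> = 2 * (lux_norm M q a + lux_norm M q b) + 2 * (ennreal (e/4) + ennreal (e/4))"
      by (simp add: algebra_simps)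
    also have "2 * (ennreal (e/4) + ennreal (e/4)) = ennreal (2 * (e/4 + e/4))"
      using e by (subst ennreal_mult, simp, simp, subst ennreal_plus) simp_all
    also have "2 * (e/4 + e/4) = e" by simp
    finally show "lux_norm M q (\<lambda>x. a x - b x) \<le> 2 * (lux_norm M q a + lux_norm M q b) + ennreal e" .
  qed
qed

lemma lux_norm_uminus [simp]: "lux_norm M q (\<lambda>x. - f x) = lux_norm M q f"
  by (simp add: lux_norm_def modular_def)

text \<open>After division by \<open>B\<close> the integrand is at most 1, and the total mass is
  1.\<close>

lemma (in prob_space) lux_norm_bounded_le:
  assumes "AE x in M. 1 \<le> q x" "\<And>x. x \<in> space M \<Longrightarrow> \<bar>g x\<bar> \<le> B" "0 < B"
  shows "lux_norm M q g \<le> ennreal B"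
proof (rule lux_norm_le[OF assms(3)])
  have "modular M q (\<lambda>x. g x / B) \<le> (\<integral>\<^sup>+ x. 1 \<partial>M)"
    unfolding modular_def
  proof (rule nn_integral_mono_AE, use assms(1) AE_space in eventually_elim)
    fix x assume x: "1 \<le> q x" "x \<in> space M"
    have "\<bar>g x / B\<bar> powr q x \<le> 1 powr q x"
      using assms(2)[OF x(2)] assms(3) x(1) by (intro powr_mono2) auto
    then show "ennreal (\<bar>g x / B\<bar> powr q x) \<le> 1" by simp
  qed
  then show "modular M q (\<lambda>x. g x / B) \<le> 1" by (simp add: emeasure_space_1)
qed

text \<open>For \<open>t \<ge> 0\<close> one has \<open>t powr r \<le> 1 + t powr q\<close>, and on
  a probability space the right-hand side integrates to at most 2. Doubling the scale gains a factor
  \<open>1/2\<close>, because \<open>r\<close> is at least 1.\<close>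

lemma (in prob_space) lux_norm_embedding:
  assumes [measurable]: "q \<in> borel_measurable M" "f \<in> borel_measurable M"
    and r: "AE x in M. 1 \<le> r x" and rq: "AE x in M. r x \<le> q x"
  shows "lux_norm M r f \<le> 2 * lux_norm M q f"
proof -
  have "lux_norm M r f \<le> ennreal 2 * lux_norm M q f"
  proof (rule lux_norm_greatest)
    fix l :: real assume l: "0 < l" "modular M q (\<lambda>x. f x / l) \<le> 1"
    have "modular M r (\<lambda>x. f x / (2 * l)) \<le> (\<integral>\<^sup>+ x. ennreal (1/2) * (1 + ennreal (\<bar>f x / l\<bar> powr q x)) \<partial>M)"
      unfolding modular_def
    proof (rule nn_integral_mono_AE, use r rq in eventually_elim)
      fix x assume x: "1 \<le> r x" "r x \<le> q x"
      have "\<bar>f x / (2 * l)\<bar> = (1/2) * \<bar>f x / l\<bar>" by (simp add: abs_mult)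
      then have "\<bar>f x / (2 * l)\<bar> powr r x = (1/2) powr r x * \<bar>f x / l\<bar> powr r x"
        by (simp only: powr_mult)
      also have "\<dots> \<le> (1/2) powr 1 * (1 + \<bar>f x / l\<bar> powr q x)"
      proof (intro mult_mono)
        show "\<bar>f x / l\<bar> powr r x \<le> 1 + \<bar>f x / l\<bar> powr q x"
        proof (cases "\<bar>f x / l\<bar> \<le> 1")
          case True
          then have "\<bar>f x / l\<bar> powr r x \<le> 1 powr r x" using x by (intro powr_mono2) auto
          then show ?thesis using powr_ge_zero[of "\<bar>f x / l\<bar>" "q x"] by (simp only: powr_one_eq_one)
        next
          case False
          then have "\<bar>f x / l\<bar> powr r x \<le> \<bar>f x / l\<bar> powr q x" using x by (intro powr_mono) auto
          then show ?thesis by linarith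
        qed
        show "(1/2) powr r x \<le> (1/2::real) powr 1" using x by (intro powr_mono') auto
      qed auto
      finally have "\<bar>f x / (2 * l)\<bar> powr r x \<le> 1/2 * (1 + \<bar>f x / l\<bar> powr q x)" by simp
      then have "ennreal (\<bar>f x / (2 * l)\<bar> powr r x) \<le> ennreal (1/2 * (1 + \<bar>f x / l\<bar> powr q x))"
        by (rule ennreal_leI)
      also have "\<dots> = ennreal (1/2) * (1 + ennreal (\<bar>f x / l\<bar> powr q x))"
        by (subst ennreal_mult, simp, simp, subst ennreal_plus) simp_all
      finally show "ennreal (\<bar>f x / (2 * l)\<bar> powr r x) \<le> ennreal (1/2) * (1 + ennreal (\<bar>f x / l\<bar> powr q x))" .
    qed
    also have "\<dots> = ennreal (1/2) * (1 + modular M q (\<lambda>x. f x / l))"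
      unfolding modular_def by (simp add: nn_integral_cmult nn_integral_add emeasure_space_1)
    also have "\<dots> \<le> ennreal (1/2) * (1 + 1)"
      using l by (intro mult_left_mono add_mono) auto
    also have "\<dots> = 1"
    proof -
      have "(1 + 1 :: ennreal) = ennreal 2" by simp
      then show ?thesis by (simp only: flip: ennreal_mult') simp
    qed
    finally show "lux_norm M r f \<le> ennreal (2 * l)" using l by (intro lux_norm_le) auto
  qed simp
  then show ?thesis by simp
qed

text \<open>A finite norm provides one scale \<open>k\<close> with finite modular; boundedness of
  the exponent allows passing to any other scale \<open>l\<close> at the cost of a constant
  factor.\<close>

lemma modular_finite:
  assumes [measurable]: "q \<in> borel_measurable M" "f \<in> borel_measurable M"
    and q: "AE x in M. 1 \<le> q x" "AE x in M. q x \<le> Q"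
    and fin: "lux_norm M q f < \<infinity>" and l: "0 < l"
  shows "modular M q (\<lambda>x. f x / l) < \<infinity>"
proof -
  obtain k where k: "0 < k" "modular M q (\<lambda>x. f x / k) \<le> 1"
    using fin by (rule lux_norm_lessE)
  \<comment> \<open>The maximum with 1 makes the power increasing in the exponent, so that
    \<open>q x\<close> can be replaced by \<open>Q\<close>.\<close>
  define c where "c = max 1 (k / l) powr Q"
  have "modular M q (\<lambda>x. f x / l) \<le> (\<integral>\<^sup>+ x. ennreal c * ennreal (\<bar>f x / k\<bar> powr q x) \<partial>M)"
    unfolding modular_def
  proof (rule nn_integral_mono_AE, use q in eventually_elim)
    fix x assume x: "1 \<le> q x" "q x \<le> Q"
    have "\<bar>f x / l\<bar> = (k / l) * \<bar>f x / k\<bar>" using k l by simp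
    then have "\<bar>f x / l\<bar> powr q x = (k / l) powr q x * \<bar>f x / k\<bar> powr q x"
      by (simp only: powr_mult)
    also have "(k / l) powr q x \<le> max 1 (k / l) powr q x"
      using x k l by (intro powr_mono2) auto
    also have "max 1 (k / l) powr q x \<le> c"
      unfolding c_def using x by (intro powr_mono) auto
    finally have "\<bar>f x / l\<bar> powr q x \<le> c * \<bar>f x / k\<bar> powr q x"
      by (simp add: mult_right_mono)
    then show "ennreal (\<bar>f x / l\<bar> powr q x) \<le> ennreal c * ennreal (\<bar>f x / k\<bar> powr q x)"
      by (subst ennreal_mult[symmetric]) (auto simp: c_def intro: ennreal_leI)
  qed
  also have "\<dots> = ennreal c * modular M q (\<lambda>x. f x / k)"
    unfolding modular_def by (simp add: nn_integral_cmult)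
  also have "\<dots> \<le> ennreal c * 1" using k by (intro mult_left_mono) auto
  also have "\<dots> < \<infinity>" by simp
  finally show ?thesis .
qed

text \<open>Embedding into the constant exponent 1, whose modular is the integral of the absolute
  value.\<close>

lemma (in prob_space) lux_norm_finite_imp_integrable:
  assumes [measurable]: "q \<in> borel_measurable M" "f \<in> borel_measurable M"
    and q: "AE x in M. 1 \<le> q x" and fin: "lux_norm M q f < \<infinity>"
  shows "integrable M f"
proof -
  have "lux_norm M (\<lambda>_. 1) f \<le> 2 * lux_norm M q f"
    by (rule lux_norm_embedding) (use q in auto)
  also have "\<dots> < \<infinity>" using fin by (simp add: ennreal_mult_less_top)
  finally have "modular M (\<lambda>_. 1) (\<lambda>x. f x / 1) < \<infinity>"
    by (intro modular_finite[where Q = 1]) auto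
  then show ?thesis
    unfolding modular_def by (intro integrableI_bounded) auto
qed

section \<open>Ergodic averages in the Luxemburg norm\<close>

context measure_preserving_system
begin

context
  fixes q :: "'a \<Rightarrow> real"
  assumes q_meas [measurable]: "q \<in> borel_measurable M"
    and q_ge: "AE x in M. 1 \<le> q x"
    and q_inv: "\<And>x. x \<in> space M \<Longrightarrow> q (T x) = q x"
begin

lemma q_iterate: "x \<in> space M \<Longrightarrow> q ((T ^^ n) x) = q x"
  by (induction n) (auto simp: q_inv iterate_in_space)

lemma ergodic_avg_powr_le:
  assumes "x \<in> space M" "1 \<le> q x"
  shows "\<bar>ergodic_avg T f n x / l\<bar> powr q x \<le> ergodic_avg T (\<lambda>x. \<bar>f x / l\<bar> powr q x) n x"
  using powr_abs_mean_le[OF assms(2), where a = "\<lambda>j. f ((T ^^ j) x) / l" and n = n]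
  by (simp add: ergodic_avg_def q_iterate[OF assms(1)] sum_divide_distrib[symmetric] mult.commute)

text \<open>Integrating the pointwise estimate \<open>ergodic_avg_powr_le\<close> gives a mean of
  \<open>n\<close> integrals, all equal because \<open>T\<close> preserves the measure. For
  \<open>n = 0\<close> the average and its modular are 0.\<close>

lemma modular_ergodic_avg_le:
  assumes [measurable]: "f \<in> borel_measurable M"
  shows "modular M q (\<lambda>x. ergodic_avg T f n x / l) \<le> modular M q (\<lambda>x. f x / l)"
proof (cases "n = 0")
  case True
  then show ?thesis by (simp add: modular_def ergodic_avg_def)
next
  case False
  let ?g = "\<lambda>x. \<bar>f x / l\<bar> powr q x"
  have [measurable]: "(\<lambda>x. ?g ((T ^^ j) x)) \<in> borel_measurable M" for j
    by (rule measurable_compose[OF iterate_measurable]) measurable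
  have "modular M q (\<lambda>x. ergodic_avg T f n x / l)
      \<le> (\<integral>\<^sup>+ x. ennreal (1 / real n) * (\<Sum>j<n. ennreal (?g ((T ^^ j) x))) \<partial>M)"
    unfolding modular_def
  proof (rule nn_integral_mono_AE, use q_ge AE_space in eventually_elim)
    fix x assume x: "1 \<le> q x" "x \<in> space M"
    have "ennreal (\<bar>ergodic_avg T f n x / l\<bar> powr q x) \<le> ennreal (ergodic_avg T ?g n x)"
      by (rule ennreal_leI[OF ergodic_avg_powr_le[OF x(2,1)]])
    also have "\<dots> = ennreal (1 / real n) * (\<Sum>j<n. ennreal (?g ((T ^^ j) x)))"
      unfolding ergodic_avg_def by (subst ennreal_mult) (auto intro: sum_nonneg)
    finally show "ennreal (\<bar>ergodic_avg T f n x / l\<bar> powr q x) \<le> ennreal (1 / real n) * (\<Sum>j<n. ennreal (?g ((T ^^ j) x)))" .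
  qed
  also have "\<dots> = ennreal (1 / real n) * (\<Sum>j<n. \<integral>\<^sup>+ x. ennreal (?g ((T ^^ j) x)) \<partial>M)"
    by (subst nn_integral_cmult, measurable, subst nn_integral_sum) auto
  also have "\<dots> = ennreal (1 / real n) * (\<Sum>j<n. modular M q (\<lambda>x. f x / l))"
    unfolding modular_def by (subst nn_integral_iterate[where g = "\<lambda>x. ennreal (?g x)"]) auto
  also have "\<dots> = modular M q (\<lambda>x. f x / l)"
    using False by (simp add: ennreal_of_nat_eq_real_of_nat mult.assoc[symmetric] ennreal_mult[symmetric])
  finally show ?thesis .
qed

text \<open>Fatou's lemma along the averages, whose modulars are all bounded by that of
  \<open>f\<close>.\<close>

lemma modular_f_av_le:
  assumes f: "integrable M f"
  shows "modular M q (\<lambda>x. f_av T f x / l) \<le> modular M q (\<lambda>x. f x / l)"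
proof -
  have [measurable]: "f \<in> borel_measurable M" using f by (rule borel_measurable_integrable)
  have "modular M q (\<lambda>x. f_av T f x / l)
      = (\<integral>\<^sup>+ x. liminf (\<lambda>n. ennreal (\<bar>ergodic_avg T f n x / l\<bar> powr q x)) \<partial>M)"
    unfolding modular_def
  proof (rule nn_integral_cong_AE, use q_ge ergodic_avg_tendsto_f_av[OF f] in eventually_elim)
    fix x assume x: "1 \<le> q x" "(\<lambda>n. ergodic_avg T f n x) \<longlonglongrightarrow> f_av T f x"
    have "(\<lambda>n. ergodic_avg T f n x / l) \<longlonglongrightarrow> f_av T f x / l"
      using tendsto_mult_right[OF x(2), of "inverse l"] by (simp only: divide_inverse)
    then have "(\<lambda>n. ennreal (\<bar>ergodic_avg T f n x / l\<bar> powr q x)) \<longlonglongrightarrow> ennreal (\<bar>f_av T f x / l\<bar> powr q x)"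
      using x(1) by (intro tendsto_ennrealI tendsto_powr2 tendsto_rabs tendsto_const always_eventually allI abs_ge_zero) simp_all
    then show "ennreal (\<bar>f_av T f x / l\<bar> powr q x) = liminf (\<lambda>n. ennreal (\<bar>ergodic_avg T f n x / l\<bar> powr q x))"
      by (intro lim_imp_Liminf[symmetric]) auto
  qed
  also have "\<dots> \<le> liminf (\<lambda>n. modular M q (\<lambda>x. ergodic_avg T f n x / l))"
    unfolding modular_def by (rule nn_integral_liminf) measurable
  also have "\<dots> \<le> liminf (\<lambda>n::nat. modular M q (\<lambda>x. f x / l))"
    by (intro Liminf_mono always_eventually allI modular_ergodic_avg_le) measurable
  also have "\<dots> = modular M q (\<lambda>x. f x / l)"
    by (simp add: Liminf_const)
  finally show ?thesis .
qed

lemma lux_norm_f_av_le: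
  assumes "integrable M f"
  shows "lux_norm M q (f_av T f) \<le> lux_norm M q f"
  unfolding lux_norm_def
  using modular_f_av_le[OF assms] by (intro INF_superset_mono) (auto intro: order_trans)

text \<open>Every scale admissible for \<open>f\<close> is admissible for \<open>f_av T f\<close>
  and for each average, so the bound is uniform in \<open>n\<close>.\<close>

lemma lux_norm_f_av_diff_le:
  assumes f: "integrable M f"
  shows "lux_norm M q (\<lambda>x. f_av T f x - ergodic_avg T f n x) \<le> 2 * lux_norm M q f"
proof -
  have [measurable]: "f \<in> borel_measurable M" using f by (rule borel_measurable_integrable)
  have "lux_norm M q (\<lambda>x. f_av T f x - ergodic_avg T f n x) \<le> ennreal 2 * lux_norm M q f"
  proof (rule lux_norm_greatest)
    fix l :: real assume "0 < l" "modular M q (\<lambda>x. f x / l) \<le> 1"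
    then show "lux_norm M q (\<lambda>x. f_av T f x - ergodic_avg T f n x) \<le> ennreal (2 * l)"
      using modular_f_av_le[OF f] modular_ergodic_avg_le[of f]
      by (intro lux_norm_le modular_half_diff q_ge) (auto intro: order_trans)
  qed simp
  then show ?thesis by simp
qed

lemma lux_norm_mean_ergodic:
  assumes [measurable]: "f \<in> borel_measurable M"
    and fin: "lux_norm M q f < \<infinity>" and Q: "AE x in M. q x \<le> Q"
  shows "(\<lambda>n. lux_norm M q (\<lambda>x. f_av T f x - ergodic_avg T f n x)) \<longlonglongrightarrow> 0"
proof (rule tendsto_0_ennrealI)
  fix e :: real assume e: "0 < e"
  \<comment> \<open>The difference is measured at the scale \<open>2 * l\<close>, which has to be
    \<open>e\<close>.\<close>
  define l where "l = e / 2"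
  have l: "0 < l" "2 * l = e" using e by (auto simp: l_def)
  have f: "integrable M f"
    using lux_norm_finite_imp_integrable[OF q_meas _ q_ge fin] by simp
  define g where "g x = \<bar>f x / l\<bar> powr q x" for x
  define h where "h x = \<bar>f_av T f x / l\<bar> powr q x" for x
  define u where "u n x = \<bar>(f_av T f x - ergodic_avg T f n x) / (2 * l)\<bar> powr q x" for n x
  define v where "v n x = (h x + ergodic_avg T g n x) / 2" for n x
  define w where "w x = (h x + f_av T g x) / 2" for x
  have [measurable]: "g \<in> borel_measurable M" "h \<in> borel_measurable M" "u n \<in> borel_measurable M" for n
    unfolding g_def h_def u_def by measurable
  \<comment> \<open>The bound \<open>Q\<close> on the exponent is what gives a finite modular at
    this particular \<open>l\<close>, and hence an integrable \<open>g\<close>.\<close>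
  have mf: "modular M q (\<lambda>x. f x / l) < \<infinity>"
    by (rule modular_finite[OF _ _ q_ge Q fin l(1)]) measurable
  have g: "integrable M g"
    by (rule integrableI_bounded) (use mf in \<open>simp_all add: modular_def g_def\<close>)
  have h: "integrable M h"
    by (rule integrableI_bounded)
      (use order.strict_trans1[OF modular_f_av_le[OF f] mf] in \<open>simp_all add: modular_def h_def\<close>)
  have v: "integrable M (v n)" for n
    unfolding v_def by (intro integrable_divide Bochner_Integration.integrable_add h integrable_ergodic_avg g)
  have w: "integrable M w"
    unfolding w_def by (intro integrable_divide Bochner_Integration.integrable_add h integrable_f_av g)
  have uv: "AE x in M. u n x \<le> v n x" for n
    using q_ge AE_space
  proof eventually_elim
    case (elim x)
    have "u n x \<le> (\<bar>f_av T f x / l\<bar> powr q x + \<bar>ergodic_avg T f n x / l\<bar> powr q x) / 2"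
      using powr_abs_half_diff_le[OF elim(1), of "f_av T f x / l" "ergodic_avg T f n x / l"]
      by (simp add: u_def diff_divide_distrib[symmetric] mult.commute)
    also have "\<dots> \<le> v n x"
      using ergodic_avg_powr_le[OF elim(2,1), of f n l] by (simp add: v_def h_def g_def[abs_def])
    finally show ?case .
  qed
  have "(\<lambda>n. \<integral>x. u n x \<partial>M) \<longlonglongrightarrow> 0"
  proof (rule integral_tendsto_0_generalized_dominated[OF _ v w _ uv])
    show "AE x in M. (\<lambda>n. u n x) \<longlonglongrightarrow> 0"
      using q_ge ergodic_avg_tendsto_f_av[OF f]
    proof eventually_elim
      case (elim x)
      have "(\<lambda>n. (f_av T f x - ergodic_avg T f n x) * inverse (2 * l)) \<longlonglongrightarrow> (f_av T f x - f_av T f x) * inverse (2 * l)"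
        by (intro tendsto_intros elim)
      then have "(\<lambda>n. u n x) \<longlonglongrightarrow> \<bar>(f_av T f x - f_av T f x) * inverse (2 * l)\<bar> powr q x"
        unfolding u_def divide_inverse using elim(1)
        by (intro tendsto_powr2 tendsto_rabs tendsto_const always_eventually allI abs_ge_zero) simp_all
      then show ?case by simp
    qed
    show "AE x in M. (\<lambda>n. v n x) \<longlonglongrightarrow> w x"
      unfolding v_def w_def using ergodic_avg_tendsto_f_av[OF g]
      by eventually_elim (intro tendsto_divide tendsto_add tendsto_const zero_neq_numeral[symmetric])
    \<comment> \<open>Averaging and passing to \<open>f_av\<close> both preserve the integral of
      \<open>g\<close>, so the integrals agree exactly for all \<open>n > 0\<close>.\<close>
    have "\<forall>\<^sub>F n in sequentially. (\<integral>x. w x \<partial>M) = (\<integral>x. v n x \<partial>M)"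
      using eventually_gt_at_top[of 0]
      by eventually_elim (simp add: v_def w_def h g integrable_ergodic_avg integrable_f_av
          integral_ergodic_avg integral_f_av)
    then show "(\<lambda>n. \<integral>x. v n x \<partial>M) \<longlonglongrightarrow> (\<integral>x. w x \<partial>M)"
      by (rule Lim_transform_eventually[OF tendsto_const])
  qed (auto simp: u_def)
  \<comment> \<open>A norm of at most \<open>e\<close> only asks for a modular of at most 1 at the
    scale \<open>e\<close>.\<close>
  then have "\<forall>\<^sub>F n in sequentially. (\<integral>x. u n x \<partial>M) < 1"
    by (rule order_tendstoD) simp
  then show "\<forall>\<^sub>F n in sequentially. lux_norm M q (\<lambda>x. f_av T f x - ergodic_avg T f n x) \<le> ennreal e"
  proof eventually_elim
    case (elim n)
    have "u n \<in> borel_measurable M" by measurable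
    moreover have "AE x in M. norm (u n x) \<le> norm (v n x)"
      using uv[of n] by eventually_elim (simp add: u_def)
    ultimately have "integrable M (u n)" by (rule Bochner_Integration.integrable_bound[OF v])
    then have "modular M q (\<lambda>x. (f_av T f x - ergodic_avg T f n x) / (2 * l)) = ennreal (\<integral>x. u n x \<partial>M)"
      unfolding modular_def u_def by (rule nn_integral_eq_integral) simp
    also have "\<dots> \<le> 1" using elim by simp
    finally show ?case using l by (intro lux_norm_le) auto
  qed
qed

end

end

section \<open>Grand variable exponent Lebesgue spaces\<close>

lemma AE_p_minus_le:
  assumes [measurable]: "p \<in> borel_measurable M" and pm: "1 < p_minus M p"
  shows "AE x in M. p_minus M p \<le> p x"
proof -
  \<comment> \<open>\<open>real_of_ereal\<close> sends both infinities to 0, which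
    \<open>1 < p_minus M p\<close> excludes.\<close>
  have "\<bar>ess_inf M p\<bar> \<noteq> \<infinity>" using pm by (auto simp: p_minus_def)
  then have eq: "ess_inf M p = ereal (p_minus M p)" by (simp add: p_minus_def ereal_real')
  have "AE x in M. - ereal (p x) \<le> - ess_inf M p"
    using esssup_AE[of "\<lambda>x. - ereal (p x)" M] by (simp add: ess_inf_def)
  then show ?thesis unfolding eq by eventually_elim simp
qed

lemma AE_le_p_plus:
  assumes "p_plus M p < \<infinity>"
  obtains P where "AE x in M. p x \<le> P"
proof -
  obtain P where "p_plus M p \<le> ereal P"
    using assms by (cases "p_plus M p") auto
  then have "AE x in M. p x \<le> P"
    using esssup_AE[of "\<lambda>x. ereal (p x)" M]
    unfolding p_plus_def by (auto elim!: eventually_mono dest: order_trans)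
  then show ?thesis by (rule that)
qed

text \<open>A continuous function is bounded on its compact support and zero elsewhere.\<close>

lemma bounded_test_function:
  assumes "h \<in> test_functions M \<phi>"
  obtains B where "0 < B" "\<And>x. x \<in> space M \<Longrightarrow> \<bar>h x\<bar> \<le> B"
proof -
  obtain g where smooth: "\<forall>k. Ck k g" and supp: "compact (closure {y. g y \<noteq> 0})"
    and h: "\<forall>x\<in>space M. h x = g (\<phi> x)"
    using assms unfolding test_functions_def mem_Collect_eq by (elim exE conjE) (rule that)
  have cont: "continuous_on UNIV g"
    using spec[OF smooth, of 0] by (simp only: Ck.simps)
  have "compact (g ` closure {y. g y \<noteq> 0})"
    by (rule compact_continuous_image[OF continuous_on_subset[OF cont subset_UNIV] supp])
  then have "bounded (g ` closure {y. g y \<noteq> 0})" by (rule compact_imp_bounded)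
  then obtain B where B: "0 < B" "\<forall>z\<in>g ` closure {y. g y \<noteq> 0}. norm z \<le> B"
    unfolding bounded_pos by (elim exE conjE)
  have "\<bar>g y\<bar> \<le> B" for y
  proof (cases "g y = 0")
    case False
    then have "y \<in> closure {y. g y \<noteq> 0}" by (intro subsetD[OF closure_subset] CollectI)
    then have "norm (g y) \<le> B" by (intro bspec[OF B(2)] imageI)
    then show ?thesis by simp
  qed (simp add: less_imp_le[OF B(1)])
  then have "\<bar>h x\<bar> \<le> B" if "x \<in> space M" for x
    using bspec[OF h that] by (simp only:)
  with B(1) show ?thesis by (rule that)
qed

section \<open>Coefficients of the grand norm and integrability\<close>

locale grand_system = measure_preserving_system M T for M :: "'a measure" and T +
  fixes p :: "'a \<Rightarrow> real" and \<theta> :: real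
  assumes p_meas [measurable]: "p \<in> borel_measurable M"
    and theta: "0 < \<theta>"
    and p_minus: "1 < p_minus M p"
    and p_plus: "p_plus M p < \<infinity>"
    and p_inv: "\<And>x. x \<in> space M \<Longrightarrow> p (T x) = p x"
begin

abbreviation "pm \<equiv> p_minus M p"

definition coef :: "real \<Rightarrow> real" where
  "coef \<epsilon> = \<epsilon> powr (\<theta> / (pm - \<epsilon>))"

lemma grand_term_coef: "grand_term M p \<theta> f \<epsilon> = ennreal (coef \<epsilon>) * lux_norm M (\<lambda>x. p x - \<epsilon>) f"
  by (simp add: grand_term_def coef_def)

text \<open>The base is below \<open>pm\<close>, and the exponent is below \<theta> since
  \<open>pm - \<epsilon> > 1\<close>; as \<open>pm > 1\<close>, the power grows in both.\<close>

lemma coef_le: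
  assumes "0 < \<epsilon>" "\<epsilon> < pm - 1"
  shows "coef \<epsilon> \<le> pm powr \<theta>"
proof -
  have "coef \<epsilon> \<le> pm powr (\<theta> / (pm - \<epsilon>))"
    unfolding coef_def using assms theta by (intro powr_mono2) auto
  also have "\<dots> \<le> pm powr \<theta>"
    using assms theta p_minus by (intro powr_mono) (auto simp: divide_le_eq)
  finally show ?thesis .
qed

text \<open>The exponent tends to \<open>\<theta> / pm > 0\<close> while the base tends to
  0.\<close>

lemma coef_tendsto_0: "(coef \<longlongrightarrow> 0) (at_right 0)"
proof -
  have "((\<lambda>\<epsilon>. \<epsilon> powr (\<theta> / (pm - \<epsilon>))) \<longlongrightarrow> 0 powr (\<theta> / (pm - 0))) (at_right 0)"
    using theta p_minus
    by (intro tendsto_powr2 tendsto_intros eventually_at_rightI[of 0 1]) auto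
  then show ?thesis by (simp add: coef_def[abs_def])
qed

lemma exponent_ge: "\<epsilon> < pm - 1 \<Longrightarrow> AE x in M. 1 \<le> p x - \<epsilon>"
  using AE_p_minus_le[OF p_meas p_minus] by eventually_elim simp

lemma exponent_meas [measurable]: "(\<lambda>x. p x - \<epsilon>) \<in> borel_measurable M"
  by measurable

lemma exponent_inv: "x \<in> space M \<Longrightarrow> p (T x) - \<epsilon> = p x - \<epsilon>"
  by (simp add: p_inv)

lemma grand_term_le_norm: "0 < \<epsilon> \<Longrightarrow> \<epsilon> < pm - 1 \<Longrightarrow> grand_term M p \<theta> f \<epsilon> \<le> grand_norm M p \<theta> f"
  unfolding grand_norm_def by (rule SUP_upper) simp

lemma lux_norm_finite:
  assumes "f \<in> grand_space M p \<theta>" "0 < \<epsilon>" "\<epsilon> < pm - 1"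
  shows "lux_norm M (\<lambda>x. p x - \<epsilon>) f < \<infinity>"
proof -
  have "grand_norm M p \<theta> f < \<infinity>" using assms(1) by (simp add: grand_space_def)
  then have "ennreal (coef \<epsilon>) * lux_norm M (\<lambda>x. p x - \<epsilon>) f < \<infinity>"
    using grand_term_le_norm[OF assms(2,3), of f] unfolding grand_term_coef by (rule le_less_trans[rotated])
  moreover have "0 < coef \<epsilon>" using assms by (simp add: coef_def)
  ultimately show ?thesis by (auto simp: ennreal_mult_less_top)
qed

text \<open>A single term of the supremum suffices; \<open>d\<close> is the midpoint of the range of
  \<epsilon>, which is nonempty because \<open>pm > 1\<close>.\<close>

lemma grand_space_integrable:
  assumes "f \<in> grand_space M p \<theta>"
  shows "integrable M f"
proof -
  define d where "d = (pm - 1) / 2"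
  have d: "0 < d" "d < pm - 1" using p_minus by (auto simp: d_def)
  show ?thesis
    using assms lux_norm_finite[OF assms d]
    by (intro lux_norm_finite_imp_integrable[OF exponent_meas[of d] _ exponent_ge[OF d(2)]])
      (auto simp: grand_space_def)
qed

section \<open>Ergodic averages in the grand norm\<close>

lemma f_av_in_grand_space:
  assumes f: "f \<in> grand_space M p \<theta>"
  shows "f_av T f \<in> grand_space M p \<theta>"
proof -
  have "grand_norm M p \<theta> (f_av T f) \<le> grand_norm M p \<theta> f"
    unfolding grand_norm_def grand_term_coef
  proof (rule SUP_subset_mono[OF subset_refl], rule mult_left_mono)
    fix \<epsilon> assume "\<epsilon> \<in> {0<..<pm - 1}"
    then show "lux_norm M (\<lambda>x. p x - \<epsilon>) (f_av T f) \<le> lux_norm M (\<lambda>x. p x - \<epsilon>) f"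
      by (intro lux_norm_f_av_le exponent_ge exponent_meas exponent_inv grand_space_integrable[OF f]) simp_all
  qed simp
  with f show ?thesis by (auto simp: grand_space_def intro: order.strict_trans1)
qed

lemma grand_vanishing_mean_ergodic:
  assumes f: "f \<in> grand_vanishing M p \<theta>"
  shows "(\<lambda>n. grand_norm M p \<theta> (\<lambda>x. f_av T f x - ergodic_avg T f n x)) \<longlonglongrightarrow> 0"
proof (rule tendsto_0_ennrealI)
  fix e :: real assume e: "0 < e"
  have fs: "f \<in> grand_space M p \<theta>" and lim: "(grand_term M p \<theta> f \<longlongrightarrow> 0) (at_right 0)"
    using f by (auto simp: grand_vanishing_def)
  have int: "integrable M f" by (rule grand_space_integrable[OF fs])
  then have [measurable]: "f \<in> borel_measurable M" by (rule borel_measurable_integrable)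
  \<comment> \<open>Half of \<open>e\<close> compensates the factor 2 in
    \<open>lux_norm_f_av_diff_le\<close>.\<close>
  have "\<forall>\<^sub>F \<epsilon> in at_right 0. grand_term M p \<theta> f \<epsilon> < ennreal (e / 2)"
    using e by (intro order_tendstoD(2)[OF lim]) simp
  then obtain b where b: "0 < b" "\<And>\<epsilon>. 0 < \<epsilon> \<Longrightarrow> \<epsilon> < b \<Longrightarrow> grand_term M p \<theta> f \<epsilon> < ennreal (e / 2)"
    unfolding eventually_at_right_field by blast
  \<comment> \<open>Below \<open>b\<close> the terms of \<open>f\<close> are small; below
    \<open>pm - 1\<close> the exponent \<open>p - d\<close> is still at least 1.\<close>
  define d where "d = min (b / 2) ((pm - 1) / 2)"
  have d: "0 < d" "d < b" "d < pm - 1" using b p_minus by (auto simp: d_def min_def)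
  obtain P where P: "AE x in M. p x \<le> P" using AE_le_p_plus[OF p_plus] .
  define r where "r n = (\<lambda>x. f_av T f x - ergodic_avg T f n x)" for n
  have [measurable]: "r n \<in> borel_measurable M" for n unfolding r_def by measurable
  have Pd: "AE x in M. p x - d \<le> P - d" using P by eventually_elim simp
  have "(\<lambda>n. lux_norm M (\<lambda>x. p x - d) (r n)) \<longlonglongrightarrow> 0"
    unfolding r_def
    by (intro lux_norm_mean_ergodic[OF exponent_meas exponent_ge[OF d(3)] exponent_inv
          _ lux_norm_finite[OF fs d(1,3)] Pd]) simp_all
  \<comment> \<open>The constant is the uniform bound on \<open>coef\<close> times the embedding
    constant 2.\<close>
  then have "(\<lambda>n. ennreal (pm powr \<theta> * 2) * lux_norm M (\<lambda>x. p x - d) (r n)) \<longlonglongrightarrow> ennreal (pm powr \<theta> * 2) * 0"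
    by (intro ennreal_tendsto_cmult) auto
  then have "\<forall>\<^sub>F n in sequentially. ennreal (pm powr \<theta> * 2) * lux_norm M (\<lambda>x. p x - d) (r n) < ennreal e"
    using e by (intro order_tendstoD(2)) auto
  then show "\<forall>\<^sub>F n in sequentially. grand_norm M p \<theta> (\<lambda>x. f_av T f x - ergodic_avg T f n x) \<le> ennreal e"
  proof eventually_elim
    case (elim n)
    have "grand_term M p \<theta> (r n) \<epsilon> \<le> ennreal e" if eps: "0 < \<epsilon>" "\<epsilon> < pm - 1" for \<epsilon>
    proof (cases "\<epsilon> < d")
      case True
      have "lux_norm M (\<lambda>x. p x - \<epsilon>) (r n) \<le> 2 * lux_norm M (\<lambda>x. p x - \<epsilon>) f"
        unfolding r_def by (intro lux_norm_f_av_diff_le exponent_ge exponent_inv int exponent_meas eps)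
      then have "grand_term M p \<theta> (r n) \<epsilon> \<le> ennreal (coef \<epsilon>) * (2 * lux_norm M (\<lambda>x. p x - \<epsilon>) f)"
        unfolding grand_term_coef by (rule mult_left_mono) simp
      also have "\<dots> = 2 * grand_term M p \<theta> f \<epsilon>"
        by (simp add: grand_term_coef ac_simps)
      also have "\<dots> \<le> ennreal 2 * ennreal (e / 2)"
        using b(2)[of \<epsilon>] eps True d by (simp add: mult_left_mono)
      also have "\<dots> = ennreal e" using e by (subst ennreal_mult[symmetric]) auto
      finally show ?thesis .
    next
      case False
      \<comment> \<open>Here \<open>\<epsilon> \<ge> d\<close>, so \<open>p - \<epsilon>\<close> is
        the smaller exponent and one norm controls all these terms at once.\<close>
      have "lux_norm M (\<lambda>x. p x - \<epsilon>) (r n) \<le> 2 * lux_norm M (\<lambda>x. p x - d) (r n)"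
        using False by (intro lux_norm_embedding exponent_ge eps) auto
      then have "grand_term M p \<theta> (r n) \<epsilon> \<le> ennreal (pm powr \<theta>) * (2 * lux_norm M (\<lambda>x. p x - d) (r n))"
        unfolding grand_term_coef using coef_le[OF eps] by (intro mult_mono ennreal_leI) auto
      also have "\<dots> = ennreal (pm powr \<theta> * 2) * lux_norm M (\<lambda>x. p x - d) (r n)"
        by (simp add: ennreal_mult mult.assoc)
      finally show ?thesis using elim by simp
    qed
    then show ?case unfolding grand_norm_def r_def by (intro SUP_least) auto
  qed
qed

text \<open>Approximate \<open>f\<close> by a bounded \<open>g\<close>: the terms of
  \<open>f - g\<close> are small uniformly in \<epsilon>, while those of \<open>g\<close> are at
  most \<open>coef \<epsilon> * B\<close> and tend to 0.\<close>

lemma grand_closure_bounded_subset_vanishing: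
  assumes D: "\<And>g. g \<in> D \<Longrightarrow> \<exists>B>0. \<forall>x\<in>space M. \<bar>g x\<bar> \<le> B"
    and f: "f \<in> grand_closure M p \<theta> D"
  shows "f \<in> grand_vanishing M p \<theta>"
proof -
  have fs: "f \<in> grand_space M p \<theta>" using f by (simp add: grand_closure_def)
  then have [measurable]: "f \<in> borel_measurable M" by (simp add: grand_space_def)
  have "(grand_term M p \<theta> f \<longlongrightarrow> 0) (at_right 0)"
  proof (rule tendsto_0_ennrealI)
    fix e :: real assume e: "0 < e"
    then obtain g where g: "g \<in> D" "g \<in> grand_space M p \<theta>"
      and fg: "grand_norm M p \<theta> (\<lambda>x. f x - g x) < ennreal (e / 4)"
      using f unfolding grand_closure_def by (auto dest!: spec[of _ "e / 4"])
    have [measurable]: "g \<in> borel_measurable M" using g by (simp add: grand_space_def)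
    obtain B where B: "0 < B" "\<And>x. x \<in> space M \<Longrightarrow> \<bar>g x\<bar> \<le> B" using D[OF g(1)] by blast
    \<comment> \<open>Multiplied by the bound \<open>B\<close> this leaves \<open>e / 4\<close>, the
      same share as for \<open>f - g\<close>; the factor 2 brings the total to
      \<open>e\<close>.\<close>
    have "\<forall>\<^sub>F \<epsilon> in at_right 0. coef \<epsilon> < e / (4 * B)"
      using e B by (intro order_tendstoD(2)[OF coef_tendsto_0]) auto
    moreover have "\<forall>\<^sub>F \<epsilon> in at_right 0. 0 < \<epsilon> \<and> \<epsilon> < pm - 1"
      using p_minus by (intro eventually_at_rightI[of 0 "pm - 1"]) auto
    ultimately show "\<forall>\<^sub>F \<epsilon> in at_right 0. grand_term M p \<theta> f \<epsilon> \<le> ennreal e"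
    proof eventually_elim
      case (elim \<epsilon>)
      then have eps: "0 < \<epsilon>" "\<epsilon> < pm - 1" by auto
      let ?q = "\<lambda>x. p x - \<epsilon>"
      have "lux_norm M ?q f \<le> 2 * (lux_norm M ?q (\<lambda>x. f x - g x) + lux_norm M ?q g)"
        \<comment> \<open>Here \<open>f\<close> is written as the difference of \<open>f - g\<close>
          and \<open>- g\<close>.\<close>
        using lux_norm_diff_le[of ?q M "\<lambda>x. f x - g x" "\<lambda>x. - g x", OF _ _ _ exponent_ge[OF eps(2)]] by simp
      then have "grand_term M p \<theta> f \<epsilon> \<le> ennreal (coef \<epsilon>) * (2 * (lux_norm M ?q (\<lambda>x. f x - g x) + lux_norm M ?q g))"
        unfolding grand_term_coef by (rule mult_left_mono) simp
      also have "\<dots> = 2 * (grand_term M p \<theta> (\<lambda>x. f x - g x) \<epsilon> + ennreal (coef \<epsilon>) * lux_norm M ?q g)"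
        by (simp add: grand_term_coef algebra_simps)
      also have "\<dots> \<le> 2 * (ennreal (e / 4) + ennreal (e / 4))"
      proof (intro mult_left_mono add_mono)
        show "grand_term M p \<theta> (\<lambda>x. f x - g x) \<epsilon> \<le> ennreal (e / 4)"
          using grand_term_le_norm[OF eps] fg by (meson le_less_trans less_imp_le)
        have "ennreal (coef \<epsilon>) * lux_norm M ?q g \<le> ennreal (e / (4 * B)) * ennreal B"
          using elim lux_norm_bounded_le[OF exponent_ge[OF eps(2)] B(2,1)]
          by (intro mult_mono ennreal_leI) auto
        also have "\<dots> = ennreal (e / 4)" using e B by (subst ennreal_mult[symmetric]) auto
        finally show "ennreal (coef \<epsilon>) * lux_norm M ?q g \<le> ennreal (e / 4)" .
      qed simp
      also have "\<dots> = ennreal (2 * (e/4 + e/4))"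
        using e by (subst ennreal_mult, simp, simp, subst ennreal_plus) simp_all
      also have "2 * (e/4 + e/4) = e" by simp
      finally show ?case .
    qed
  qed
  with fs show ?thesis by (simp add: grand_vanishing_def)
qed

end

text \<open>If \<open>p_minus M p = 1\<close>, the supremum runs over the empty set and the grand
  space contains every measurable function, integrable or not; hence the strict inequality.
  Integrability is part of the conclusion because the integral of a non-integrable function defaults
  to 0. Norm convergence is given for both descriptions of the closure: the vanishing condition and
  approximation by test functions.\<close>

theorem theorem1:
  fixes M :: "'a measure" and p :: "'a \<Rightarrow> real" and \<theta> :: real and T :: "'a \<Rightarrow> 'a"
  assumes "prob_space M"
    and "0 < \<theta>"
    and "p \<in> borel_measurable M"
    and "\<forall>x\<in>space M. 1 \<le> p x"
    and "1 < p_minus M p"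
    and "p_plus M p < \<infinity>"
    and "measure_preserving M T"
    and "\<forall>x\<in>space M. p (T x) = p x"
  shows "(\<forall>f \<in> grand_space M p \<theta>.
            (AE x in M. convergent (\<lambda>n. ergodic_avg T f n x)) \<and>
            f_av T f \<in> grand_space M p \<theta>)
       \<and> (\<forall>f \<in> grand_space M p \<theta>.
            (AE x in M. f_av T f x = f_av T f (T x)) \<and>
            integrable M f \<and> integrable M (f_av T f) \<and>
            (\<integral>x. f_av T f x \<partial>M) = (\<integral>x. f x \<partial>M))
       \<and> (\<forall>f \<in> grand_vanishing M p \<theta>.
            (\<lambda>n. grand_norm M p \<theta> (\<lambda>x. f_av T f x - ergodic_avg T f n x)) \<longlonglongrightarrow> 0)
       \<and> (\<forall>\<phi> :: 'a \<Rightarrow> 'e::euclidean_space. euclidean_domain M \<phi> \<longrightarrow>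
            (\<forall>f \<in> grand_closure M p \<theta> (test_functions M \<phi>).
              (\<lambda>n. grand_norm M p \<theta> (\<lambda>x. f_av T f x - ergodic_avg T f n x)) \<longlonglongrightarrow> 0))"
proof -
  interpret prob_space M by fact
  interpret grand_system M T p \<theta>
    using assms by unfold_locales auto
  show ?thesis
  proof (intro conjI ballI allI impI)
    fix f assume f: "f \<in> grand_space M p \<theta>"
    note int = grand_space_integrable[OF f]
    show "AE x in M. convergent (\<lambda>n. ergodic_avg T f n x)"
      using ergodic_avg_tendsto_f_av[OF int] by eventually_elim (auto simp: convergent_def)
    show "f_av T f \<in> grand_space M p \<theta>" by (rule f_av_in_grand_space[OF f])
    show "AE x in M. f_av T f x = f_av T f (T x)" by (rule f_av_invariant[OF int])
    show "integrable M f" by (rule int)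
    show "integrable M (f_av T f)" by (rule integrable_f_av[OF int])
    show "(\<integral>x. f_av T f x \<partial>M) = (\<integral>x. f x \<partial>M)" by (rule integral_f_av[OF int])
  next
    fix f assume "f \<in> grand_vanishing M p \<theta>"
    then show "(\<lambda>n. grand_norm M p \<theta> (\<lambda>x. f_av T f x - ergodic_avg T f n x)) \<longlonglongrightarrow> 0"
      by (rule grand_vanishing_mean_ergodic)
  next
    fix \<phi> :: "'a \<Rightarrow> 'e" and f
    assume "f \<in> grand_closure M p \<theta> (test_functions M \<phi>)"
    \<comment> \<open>Test functions are bounded, so their closure lies in the vanishing
      class.\<close>
    then have "f \<in> grand_vanishing M p \<theta>"
      using bounded_test_function[of _ M \<phi>]
      by (intro grand_closure_bounded_subset_vanishing[of "test_functions M \<phi>"]) metis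
    then show "(\<lambda>n. grand_norm M p \<theta> (\<lambda>x. f_av T f x - ergodic_avg T f n x)) \<longlonglongrightarrow> 0"
      by (rule grand_vanishing_mean_ergodic)
  qed
qed

end
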